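(* Let $\mathcal{C}\le\mathcal{G}=\mathbb{Z}_2^{k_1}\times\mathbb{Z}_4^{k_2}\times Q_8^{k_3}$ be such that $C=\Phi(\mathcal{C})$ is a binary Hadamard code of length $2^m$, let $\mathcal{A}=\mathcal{A}(\mathcal{C})$ be its standard abelian subgroup and $2^\upsilon=|\mathcal{C}/\mathcal{A}|$. If $\upsilon=1$, then $\Phi(\mathcal{A})$ is a duplication of a Hadamard $\mathbb{Z}_2\mathbb{Z}_4$-linear code; if $\upsilon=2$, then $\Phi(\mathcal{A})$ is a quadruplication of a Hadamard $\mathbb{Z}_4$-linear code.
   Context: $Q_8=\langle \mathbf{a},\mathbf{b} : \mathbf{a}^4=\mathbf{a}^2\mathbf{b}^2=\mathbf{1},\ \mathbf{b}\mathbf{a}\mathbf{b}^{-1}=\mathbf{a}^{-1}\rangle$; $\mathcal{G}$ is written multiplicatively with identity $\mathbf{e}$, and $\mathbf{u}=(1,\dots,1,2,\dots,2,\mathbf{a}^2,\dots,\mathbf{a}^2)\in\mathcal{G}$. The Gray map $\Phi$ acts componentwise: identity on $\mathbb{Z}_2$; $0\mapsto00,1\mapsto01,2\mapsto11,3\mapsto10$ on $\mathbb{Z}_4$; $\mathbf{1}\mapsto0000$, $\mathbf{b}\mapsto0110$, $\mathbf{a}\mapsto0101$, $\mathbf{a}\mathbf{b}\mapsto1100$, $\mathbf{a}^2\mapsto1111$, $\mathbf{a}^2\mathbf{b}\mapsto1001$, $\mathbf{a}^3\mapsto1010$, $\mathbf{a}^3\mathbf{b}\mapsto0011$ on $Q_8$.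 A binary Hadamard code of length $n$ is the set of rows of a normalized binary Hadamard matrix of order $n$ together with their complements. A Hadamard $\mathbb{Z}_2\mathbb{Z}_4$-linear code is $\Phi(\mathcal{D})$ for a subgroup $\mathcal{D}\le\mathbb{Z}_2^{a}\times\mathbb{Z}_4^{b}$ with $\Phi(\mathcal{D})$ a Hadamard code; it is $\mathbb{Z}_4$-linear if $a=0$. "Duplication" (resp. "quadruplication") of a code $D$ means the code $\{(v,v):v\in D\}$ (resp. $\{(v,v,v,v):v\in D\}$), up to a permutation of coordinates, i.e. every coordinate column is repeated twice (resp. four times). $[a,b]$ denotes the commutator: $ab=[a,b]ba$. $T(\mathcal{C})$ is the subgroup of elements of order $\le2$, $Z(\mathcal{C})$ the center. Normalized generators (from earlier work): $\mathcal{C}=\langle x_1,\dots,x_\sigma;y_1,\dots,y_\delta;z_1,\dots,z_\rho\rangle$ with $T(\mathcal{C})=\langle x_i\rangle$ of order $2^\sigma$, $Z(\mathcal{C})=\langle x_i,y_j\rangle$, $|Z(\mathcal{C})/T(\mathcal{C})|=2^\delta$, $|\mathcal{C}/Z(\mathcal{C})|=2^\rho$, and $\mathcal{C}$ has one of the shapes: (1) $\rho=0$ and $\mathbf{u}$ is not the square of an element of $\mathcal{C}$; (1* ) $\rho=0$ and $\mathbf{u}$ is such a square; (2) $\delta=0$, $z_1^2=z_2^2=[z_1,z_2]=\mathbf{u}$, $[z_i,z_j]=z_j^2$, $[z_j,z_k]=\mathbf{e}$ for $i\in\{1,2\}$, $3\le j,k\le\rho$; (3) $\delta=0$, $z_1^2=\mathbf{u}\notin\langle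 z_2^2,\dots,z_\rho^2\rangle$, $[z_1,z_i]=z_i^2$, $[z_i,z_j]=\mathbf{e}$ for $i\ne j$ in $\{2,\dots,\rho\}$; (4) $\delta=0$, $\rho=2$, $z_1^2=z_2^2=[z_1,z_2]\ne\mathbf{u}$; (4* ) $\delta=1$, $\rho=2$, $z_1^2=z_2^2=[z_1,z_2]\ne\mathbf{u}$; (5) $\delta=0$, $\rho=4$, $z_1^2=z_2^2=[z_1,z_2]=\mathbf{u}\ne z_3^2=z_4^2=[z_3,z_4]$, $[z_i,z_j]\in\langle z_j^2\rangle$ for $i\in\{1,2\},j\in\{3,4\}$. Standard abelian subgroup: $\mathcal{A}(\mathcal{C})=\mathcal{C}$ in shapes 1, 1*; $\langle T(\mathcal{C}),z_1z_2,z_3,\dots,z_\rho\rangle$ in shape 2; $\langle T(\mathcal{C}),z_2,\dots,z_\rho\rangle$ in shape 3; $\langle T(\mathcal{C}),z_1\rangle$ in shape 4; $\langle T(\mathcal{C}),y_1z_1,z_1\rangle$ in shape 4*; $\langle T(\mathcal{C}),z_1,f(z_1)\rangle$ in shape 5, where $f(z)=z_3$ if $[z,z_3]=\mathbf{e}$, $f(z)=z_4$ if $[z,z_4]=\mathbf{e}$, and $f(z)=z_3z_4$ otherwise. *)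

theory Defs
  imports
    "HOL-Library.Z2"
    "HOL-Algebra.Elementary_Groups"
    "HOL-Algebra.Product_Groups"
    "HOL-Combinatorics.Permutations"
    "Jordan_Normal_Form.Matrix"
begin

section \<open>The ambient group\<close>

text \<open>The pair \<open>(i, j)\<close> stands for \<open>a\<^sup>i b\<^sup>j\<close>; the product formula is obtained from
  \<open>b a = a\<^sup>-\<^sup>1 b\<close> and \<open>b\<^sup>2 = a\<^sup>2\<close>.\<close>

definition Q8 :: "(int \<times> int) monoid" where
  "Q8 = \<lparr>carrier = {0..<4} \<times> {0..<2},
         monoid.mult = (\<lambda>(i, j) (k, l).
           ((i + (if j = 0 then k else - k) + 2 * j * l) mod 4, (j + l) mod 2)),
         one = (0, 0)\<rparr>"

definition qa :: "int \<times> int" where "qa = (1, 0)"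

definition qb :: "int \<times> int" where "qb = (0, 1)"

definition Z2Z4_group :: "nat \<Rightarrow> nat \<Rightarrow> ((nat \<Rightarrow> int) \<times> (nat \<Rightarrow> int)) monoid" where
  "Z2Z4_group k1 k2 =
     product_group {..<k1} (\<lambda>_. integer_mod_group 2) \<times>\<times>
     product_group {..<k2} (\<lambda>_. integer_mod_group 4)"

type_synonym Z2Z4Q8_elem = "((nat \<Rightarrow> int) \<times> (nat \<Rightarrow> int)) \<times> (nat \<Rightarrow> int \<times> int)"

definition Z2Z4Q8_group :: "nat \<Rightarrow> nat \<Rightarrow> nat \<Rightarrow> Z2Z4Q8_elem monoid" where
  "Z2Z4Q8_group k1 k2 k3 = Z2Z4_group k1 k2 \<times>\<times> product_group {..<k3} (\<lambda>_. Q8)"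

definition u_elem :: "nat \<Rightarrow> nat \<Rightarrow> nat \<Rightarrow> Z2Z4Q8_elem" where
  "u_elem k1 k2 k3 =
     ((\<lambda>i\<in>{..<k1}. 1, \<lambda>i\<in>{..<k2}. 2), \<lambda>i\<in>{..<k3}. qa [^]\<^bsub>Q8\<^esub> (2::nat))"

section \<open>The Gray map\<close>

definition gray_Z2 :: "int \<Rightarrow> bit list" where
  "gray_Z2 x = the (map_of [(0, [0]), (1, [1])] x)"

definition gray_Z4 :: "int \<Rightarrow> bit list" where
  "gray_Z4 x = the (map_of [(0, [0,0]), (1, [0,1]), (2, [1,1]), (3, [1,0])] x)"

definition gray_Q8 :: "int \<times> int \<Rightarrow> bit list" where
  "gray_Q8 g = the (map_of
     [((0, 0), [0,0,0,0]), ((0, 1), [0,1,1,0]),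
      ((1, 0), [0,1,0,1]), ((1, 1), [1,1,0,0]),
      ((2, 0), [1,1,1,1]), ((2, 1), [1,0,0,1]),
      ((3, 0), [1,0,1,0]), ((3, 1), [0,0,1,1])] g)"

definition gray_Z2Z4 :: "nat \<Rightarrow> nat \<Rightarrow> (nat \<Rightarrow> int) \<times> (nat \<Rightarrow> int) \<Rightarrow> bit list" where
  "gray_Z2Z4 k1 k2 = (\<lambda>(x, y).
     concat (map (\<lambda>i. gray_Z2 (x i)) [0..<k1]) @ concat (map (\<lambda>i. gray_Z4 (y i)) [0..<k2]))"

definition gray :: "nat \<Rightarrow> nat \<Rightarrow> nat \<Rightarrow> Z2Z4Q8_elem \<Rightarrow> bit list" where
  "gray k1 k2 k3 = (\<lambda>(v, w).
     gray_Z2Z4 k1 k2 v @ concat (map (\<lambda>i. gray_Q8 (w i)) [0..<k3]))"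

section \<open>Hadamard codes\<close>

definition hadamard_matrix :: "nat \<Rightarrow> int mat \<Rightarrow> bool" where
  "hadamard_matrix n H \<longleftrightarrow>
     0 < n \<and> H \<in> carrier_mat n n \<and> (\<forall>i<n. \<forall>j<n. H $$ (i, j) \<in> {1, - 1}) \<and>
     H * transpose_mat H = int n \<cdot>\<^sub>m 1\<^sub>m n"

definition normalized_hadamard_matrix :: "nat \<Rightarrow> int mat \<Rightarrow> bool" where
  "normalized_hadamard_matrix n H \<longleftrightarrow>
     hadamard_matrix n H \<and> (\<forall>j<n. H $$ (0, j) = 1) \<and> (\<forall>i<n. H $$ (i, 0) = 1)"

definition binary_mat :: "int mat \<Rightarrow> bit mat" where
  "binary_mat H = map_mat (\<lambda>h. if h = 1 then 0 else 1) H"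

definition hadamard_code :: "nat \<Rightarrow> bit list set \<Rightarrow> bool" where
  "hadamard_code n K \<longleftrightarrow>
     (\<exists>H. normalized_hadamard_matrix n H \<and>
        (let R = (\<lambda>i. list_of_vec (row (binary_mat H) i)) ` {..<n}
         in K = R \<union> map (\<lambda>c. 1 + c) ` R))"

definition hadamard_Z2Z4_linear_code :: "nat \<Rightarrow> nat \<Rightarrow> bit list set \<Rightarrow> bool" where
  "hadamard_Z2Z4_linear_code a b K \<longleftrightarrow>
     (\<exists>D. subgroup D (Z2Z4_group a b) \<and> K = gray_Z2Z4 a b ` D) \<and>
     hadamard_code (a + 2 * b) K"

text \<open>\<open>K\<close> is, up to a permutation of coordinates, the code of all \<open>(v, \<dots>, v)\<close> (\<open>r\<close> copies)
  with \<open>v\<close> in the code \<open>D\<close>.\<close>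

definition is_replication :: "nat \<Rightarrow> bit list set \<Rightarrow> bit list set \<Rightarrow> bool" where
  "is_replication r D K \<longleftrightarrow>
     (\<exists>n p. (\<forall>v\<in>D. length v = n) \<and> p permutes {..<r * n} \<and>
        K = (\<lambda>v. permute_list p (concat (replicate r v))) ` D)"

abbreviation is_duplication :: "bit list set \<Rightarrow> bit list set \<Rightarrow> bool" where
  "is_duplication \<equiv> is_replication 2"

abbreviation is_quadruplication :: "bit list set \<Rightarrow> bit list set \<Rightarrow> bool" where
  "is_quadruplication \<equiv> is_replication 4"

section \<open>Normalized generators and the standard abelian subgroup\<close>

definition commutator :: "('a, 'b) monoid_scheme \<Rightarrow> 'a \<Rightarrow> 'a \<Rightarrow> 'a" where
  "commutator G g h = g \<otimes>\<^bsub>G\<^esub> h \<otimes>\<^bsub>G\<^esub> inv\<^bsub>G\<^esub> g \<otimes>\<^bsub>G\<^esub> inv\<^bsub>G\<^esub> h"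

definition T_part :: "('a, 'b) monoid_scheme \<Rightarrow> 'a set \<Rightarrow> 'a set" where
  "T_part G C = {g \<in> C. g [^]\<^bsub>G\<^esub> (2::nat) = \<one>\<^bsub>G\<^esub>}"

definition center_of :: "('a, 'b) monoid_scheme \<Rightarrow> 'a set \<Rightarrow> 'a set" where
  "center_of G C = {g \<in> C. \<forall>h\<in>C. g \<otimes>\<^bsub>G\<^esub> h = h \<otimes>\<^bsub>G\<^esub> g}"

definition generated_normally ::
    "('a, 'b) monoid_scheme \<Rightarrow> 'a set \<Rightarrow> nat \<Rightarrow> nat \<Rightarrow> nat \<Rightarrow>
     (nat \<Rightarrow> 'a) \<Rightarrow> (nat \<Rightarrow> 'a) \<Rightarrow> (nat \<Rightarrow> 'a) \<Rightarrow> bool" where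
  "generated_normally G C \<sigma> \<delta> \<rho> x y z \<longleftrightarrow>
     x ` {1..\<sigma>} \<union> y ` {1..\<delta>} \<union> z ` {1..\<rho>} \<subseteq> C \<and>
     C = generate G (x ` {1..\<sigma>} \<union> y ` {1..\<delta>} \<union> z ` {1..\<rho>}) \<and>
     T_part G C = generate G (x ` {1..\<sigma>}) \<and>
     card (T_part G C) = 2 ^ \<sigma> \<and>
     center_of G C = generate G (x ` {1..\<sigma>} \<union> y ` {1..\<delta>}) \<and>
     order (G\<lparr>carrier := center_of G C\<rparr> Mod T_part G C) = 2 ^ \<delta> \<and>
     order (G\<lparr>carrier := C\<rparr> Mod center_of G C) = 2 ^ \<rho>"

text \<open>The suffix \<open>s\<close> marks the starred shapes. In shapes 2 and 3 the lower bounds on \<open>\<rho>\<close> only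
  say that the generators \<open>z 1\<close>, \<open>z 2\<close> singled out there exist.\<close>

datatype shape = Shape1 | Shape1s | Shape2 | Shape3 | Shape4 | Shape4s | Shape5

fun has_shape ::
    "('a, 'b) monoid_scheme \<Rightarrow> 'a \<Rightarrow> 'a set \<Rightarrow> nat \<Rightarrow> nat \<Rightarrow> (nat \<Rightarrow> 'a) \<Rightarrow> shape \<Rightarrow> bool" where
  "has_shape G u C \<delta> \<rho> z Shape1 \<longleftrightarrow>
     \<rho> = 0 \<and> \<not> (\<exists>c\<in>C. u = c [^]\<^bsub>G\<^esub> (2::nat))"
| "has_shape G u C \<delta> \<rho> z Shape1s \<longleftrightarrow>
     \<rho> = 0 \<and> (\<exists>c\<in>C. u = c [^]\<^bsub>G\<^esub> (2::nat))"
| "has_shape G u C \<delta> \<rho> z Shape2 \<longleftrightarrow>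
     \<delta> = 0 \<and> 2 \<le> \<rho> \<and>
     z 1 [^]\<^bsub>G\<^esub> (2::nat) = u \<and> z 2 [^]\<^bsub>G\<^esub> (2::nat) = u \<and> commutator G (z 1) (z 2) = u \<and>
     (\<forall>i\<in>{1, 2}. \<forall>j\<in>{3..\<rho>}. commutator G (z i) (z j) = z j [^]\<^bsub>G\<^esub> (2::nat)) \<and>
     (\<forall>j\<in>{3..\<rho>}. \<forall>k\<in>{3..\<rho>}. commutator G (z j) (z k) = \<one>\<^bsub>G\<^esub>)"
| "has_shape G u C \<delta> \<rho> z Shape3 \<longleftrightarrow>
     \<delta> = 0 \<and> 1 \<le> \<rho> \<and>
     z 1 [^]\<^bsub>G\<^esub> (2::nat) = u \<and> u \<notin> generate G ((\<lambda>i. z i [^]\<^bsub>G\<^esub> (2::nat)) ` {2..\<rho>}) \<and>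
     (\<forall>i\<in>{2..\<rho>}. commutator G (z 1) (z i) = z i [^]\<^bsub>G\<^esub> (2::nat)) \<and>
     (\<forall>i\<in>{2..\<rho>}. \<forall>j\<in>{2..\<rho>}. i \<noteq> j \<longrightarrow> commutator G (z i) (z j) = \<one>\<^bsub>G\<^esub>)"
| "has_shape G u C \<delta> \<rho> z Shape4 \<longleftrightarrow>
     \<delta> = 0 \<and> \<rho> = 2 \<and>
     z 1 [^]\<^bsub>G\<^esub> (2::nat) = z 2 [^]\<^bsub>G\<^esub> (2::nat) \<and>
     z 2 [^]\<^bsub>G\<^esub> (2::nat) = commutator G (z 1) (z 2) \<and> commutator G (z 1) (z 2) \<noteq> u"
| "has_shape G u C \<delta> \<rho> z Shape4s \<longleftrightarrow>
     \<delta> = 1 \<and> \<rho> = 2 \<and>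
     z 1 [^]\<^bsub>G\<^esub> (2::nat) = z 2 [^]\<^bsub>G\<^esub> (2::nat) \<and>
     z 2 [^]\<^bsub>G\<^esub> (2::nat) = commutator G (z 1) (z 2) \<and> commutator G (z 1) (z 2) \<noteq> u"
| "has_shape G u C \<delta> \<rho> z Shape5 \<longleftrightarrow>
     \<delta> = 0 \<and> \<rho> = 4 \<and>
     z 1 [^]\<^bsub>G\<^esub> (2::nat) = u \<and> z 2 [^]\<^bsub>G\<^esub> (2::nat) = u \<and> commutator G (z 1) (z 2) = u \<and>
     u \<noteq> z 3 [^]\<^bsub>G\<^esub> (2::nat) \<and> z 3 [^]\<^bsub>G\<^esub> (2::nat) = z 4 [^]\<^bsub>G\<^esub> (2::nat) \<and>
     z 4 [^]\<^bsub>G\<^esub> (2::nat) = commutator G (z 3) (z 4) \<and>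
     (\<forall>i\<in>{1, 2}. \<forall>j\<in>{3, 4}.
        commutator G (z i) (z j) \<in> generate G {z j [^]\<^bsub>G\<^esub> (2::nat)})"

text \<open>In shape 5, \<open>z 1\<close> cannot commute with both \<open>z 3\<close> and \<open>z 4\<close> (otherwise it would be
  central, hence of order at most 2, at a \<open>Q8\<close>-coordinate where \<open>(z 3)\<^sup>2\<close> is nontrivial), so the
  order of the first two cases is immaterial at \<open>z 1\<close>.\<close>

definition f_elem :: "('a, 'b) monoid_scheme \<Rightarrow> (nat \<Rightarrow> 'a) \<Rightarrow> 'a \<Rightarrow> 'a" where
  "f_elem G z g =
     (if commutator G g (z 3) = \<one>\<^bsub>G\<^esub> then z 3
      else if commutator G g (z 4) = \<one>\<^bsub>G\<^esub> then z 4
      else z 3 \<otimes>\<^bsub>G\<^esub> z 4)"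

fun standard_abelian_subgroup ::
    "('a, 'b) monoid_scheme \<Rightarrow> 'a set \<Rightarrow> nat \<Rightarrow> (nat \<Rightarrow> 'a) \<Rightarrow> (nat \<Rightarrow> 'a) \<Rightarrow> shape \<Rightarrow> 'a set"
where
  "standard_abelian_subgroup G C \<rho> y z Shape1 = C"
| "standard_abelian_subgroup G C \<rho> y z Shape1s = C"
| "standard_abelian_subgroup G C \<rho> y z Shape2 =
     generate G (T_part G C \<union> {z 1 \<otimes>\<^bsub>G\<^esub> z 2} \<union> z ` {3..\<rho>})"
| "standard_abelian_subgroup G C \<rho> y z Shape3 = generate G (T_part G C \<union> z ` {2..\<rho>})"
| "standard_abelian_subgroup G C \<rho> y z Shape4 = generate G (T_part G C \<union> {z 1})"
| "standard_abelian_subgroup G C \<rho> y z Shape4s =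
     generate G (T_part G C \<union> {y 1 \<otimes>\<^bsub>G\<^esub> z 1, z 1})"
| "standard_abelian_subgroup G C \<rho> y z Shape5 =
     generate G (T_part G C \<union> {z 1, f_elem G z (z 1)})"

section \<open>Consistency of the encodings\<close>

lemma carrier_Q8: "carrier Q8 = {(0,0),(1,0),(2,0),(3,0),(0,1),(1,1),(2,1),(3,1)}"
proof -
  have "{0..<4::int} = {0,1,2,3}" "{0..<2::int} = {0,1}" by auto
  then show ?thesis by (auto simp: Q8_def)
qed

lemma group_Q8: "group Q8"
proof (rule groupI)
  fix x y assume "x \<in> carrier Q8" "y \<in> carrier Q8"
  then show "x \<otimes>\<^bsub>Q8\<^esub> y \<in> carrier Q8" by (auto simp: Q8_def)
next
  show "\<one>\<^bsub>Q8\<^esub> \<in> carrier Q8" by (simp add: Q8_def)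
next
  fix x y w assume *: "x \<in> carrier Q8" "y \<in> carrier Q8" "w \<in> carrier Q8"
  obtain i j k l p q where eq: "x = (i, j)" "y = (k, l)" "w = (p, q)"
    by (metis surj_pair)
  with * have "j = 0 \<or> j = 1" "l = 0 \<or> l = 1" "q = 0 \<or> q = 1"
    by (auto simp: Q8_def)
  then show "x \<otimes>\<^bsub>Q8\<^esub> y \<otimes>\<^bsub>Q8\<^esub> w = x \<otimes>\<^bsub>Q8\<^esub> (y \<otimes>\<^bsub>Q8\<^esub> w)"
    unfolding eq by (elim disjE; simp add: Q8_def; presburger)
next
  fix x assume "x \<in> carrier Q8"
  then show "\<one>\<^bsub>Q8\<^esub> \<otimes>\<^bsub>Q8\<^esub> x = x" by (auto simp: Q8_def)
next
  fix x assume "x \<in> carrier Q8"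
  then show "\<exists>y\<in>carrier Q8. y \<otimes>\<^bsub>Q8\<^esub> x = \<one>\<^bsub>Q8\<^esub>"
    unfolding carrier_Q8 by (elim insertE emptyE; simp add: Q8_def)
qed

lemma Q8_relations:
  "qa [^]\<^bsub>Q8\<^esub> (4::nat) = \<one>\<^bsub>Q8\<^esub>"
  "qa [^]\<^bsub>Q8\<^esub> (2::nat) \<otimes>\<^bsub>Q8\<^esub> qb [^]\<^bsub>Q8\<^esub> (2::nat) = \<one>\<^bsub>Q8\<^esub>"
  "qb \<otimes>\<^bsub>Q8\<^esub> qa \<otimes>\<^bsub>Q8\<^esub> inv\<^bsub>Q8\<^esub> qb = inv\<^bsub>Q8\<^esub> qa"
proof -
  interpret group Q8 by (rule group_Q8)
  have "inv\<^bsub>Q8\<^esub> qa = (3, 0)"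
    by (rule inv_equality) (auto simp: Q8_def qa_def)
  moreover have "inv\<^bsub>Q8\<^esub> qb = (2, 1)"
    by (rule inv_equality) (auto simp: Q8_def qb_def)
  ultimately show "qb \<otimes>\<^bsub>Q8\<^esub> qa \<otimes>\<^bsub>Q8\<^esub> inv\<^bsub>Q8\<^esub> qb = inv\<^bsub>Q8\<^esub> qa"
    by (simp add: Q8_def qa_def qb_def)
  show "qa [^]\<^bsub>Q8\<^esub> (4::nat) = \<one>\<^bsub>Q8\<^esub>"
    "qa [^]\<^bsub>Q8\<^esub> (2::nat) \<otimes>\<^bsub>Q8\<^esub> qb [^]\<^bsub>Q8\<^esub> (2::nat) = \<one>\<^bsub>Q8\<^esub>"
    by (simp_all add: numeral_eq_Suc nat_pow_Suc nat_pow_0 del: One_nat_def)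
      (simp_all add: Q8_def qa_def qb_def)
qed

lemma Q8_normal_form:
  assumes "(i, j) \<in> carrier Q8"
  shows "(i, j) = qa [^]\<^bsub>Q8\<^esub> nat i \<otimes>\<^bsub>Q8\<^esub> qb [^]\<^bsub>Q8\<^esub> nat j"
proof -
  interpret group Q8 by (rule group_Q8)
  show ?thesis
    using assms unfolding carrier_Q8
    by (elim insertE emptyE)
      (auto simp: numeral_eq_Suc nat_pow_Suc nat_pow_0 Q8_def qa_def qb_def)
qed

lemma card_Q8: "card (carrier Q8) = 8"
  by (simp add: carrier_Q8)

lemma group_Z2Z4: "group (Z2Z4_group k1 k2)"
  unfolding Z2Z4_group_def by (intro DirProd_group) (simp_all add: group_integer_mod_group)

lemma group_Z2Z4Q8: "group (Z2Z4Q8_group k1 k2 k3)"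
  unfolding Z2Z4Q8_group_def by (intro DirProd_group group_Z2Z4) (simp add: group_Q8)

end

theory Submission
  imports Defs
begin

text \<open>Restricted to an abelian subgroup \<open>A\<close>, every coordinate of the Gray image is a function of a
  character of \<open>A\<close> with values in \<open>{1, \<i>, -1, -\<i>}\<close>, and the sum of all these characters is
  \<open>n - 2 wt\<close>. In a Hadamard code of length \<open>n\<close> this sum is \<open>n\<close> at the identity, \<open>-n\<close> at \<open>u\<close>
  and \<open>0\<close> elsewhere, so by orthogonality every character \<open>\<psi>\<close> with \<open>\<psi>(u) = -1\<close> occurs exactly
  \<open>2n / |A| = 2\<^sup>\<upsilon>\<close> times. Keeping one copy of each character, with the real ones as \<open>Z\<^sub>2\<close>-coordinates
  and the conjugate pairs as \<open>Z\<^sub>4\<close>-coordinates, gives the replicated code. If \<open>u\<close> is a square in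
  \<open>A\<close>, no real character takes the value \<open>-1\<close> at \<open>u\<close>; this is the case in shape 5, the only shape
  with \<open>\<upsilon> = 2\<close>.\<close>

section \<open>Coordinate characters of the Gray map\<close>

text \<open>No coordinate of \<open>chi_Q8\<close> is a character of Q8: the one-dimensional
  characters of Q8 are real, while these coordinates take the values \<i> and -\<i>. They are
  multiplicative only on commuting pairs, and this is where commutativity of \<open>A\<close>
  enters. A single sign is not the character value w itself but Re w - Im w; the two agree only
  after summing over a Z4 or Q8 block, where the imaginary parts cancel. The equality 2n / |A| =
  2^\<upsilon> is Lagrange together with |C| = 2n, since a Hadamard code of length n has 2n words.
  Orthogonality of the shortened code needs no new character sum: all multiplicities are equal, so
  its correlations are those of the long code divided by the multiplicity. In shape 5 the index is
  never computed. The other shapes are shown to have index at most 2, which works because squares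
  and commutators of elements of C have trivial square and hence already lie in T(C).\<close>

definition sgn_bit :: "bit \<Rightarrow> int" where
  "sgn_bit b = (if b = 0 then 1 else - 1)"

definition fourth_roots :: "complex set" where
  "fourth_roots = {1, \<i>, - 1, - \<i>}"

text \<open>Chosen so that (-1)^bit = Re w - Im w on the fourth roots of unity; the signs of a
  conjugate pair then add up to w + cnj w.\<close>

definition root_bit :: "complex \<Rightarrow> bit" where
  "root_bit w = (if w = - 1 \<or> w = \<i> then 1 else 0)"

definition chi_Z2 :: "int \<Rightarrow> complex list" where
  "chi_Z2 x = (if x = 0 then [1] else [- 1])"

text \<open>The entries are (-\<i>)^y and \<i>^y, a conjugate pair in the order that matches the two
  Gray bits under \<open>root_bit\<close>.\<close>

definition chi_Z4 :: "int \<Rightarrow> complex list" where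
  "chi_Z4 x = (if x = 0 then [1, 1] else if x = 1 then [- \<i>, \<i>]
     else if x = 2 then [- 1, - 1] else [\<i>, - \<i>])"

text \<open>On an element of order 4 the character of a bit is \<open>\<i>\<close> or \<open>-\<i>\<close> according to that bit; this
  is multiplicative because inversion of such an element complements its Gray image.\<close>

definition chi_Q8 :: "int \<times> int \<Rightarrow> complex list" where
  "chi_Q8 g = (if g = (0, 0) then [1, 1, 1, 1] else if g = (2, 0) then [- 1, - 1, - 1, - 1]
     else map (\<lambda>b. if b = 1 then \<i> else - \<i>) (gray_Q8 g))"

definition chi :: "nat \<Rightarrow> nat \<Rightarrow> nat \<Rightarrow> Z2Z4Q8_elem \<Rightarrow> complex list" where
  "chi k1 k2 k3 = (\<lambda>((x, y), w).
     concat (map (\<lambda>i. chi_Z2 (x i)) [0..<k1]) @ concat (map (\<lambda>i. chi_Z4 (y i)) [0..<k2]) @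
     concat (map (\<lambda>i. chi_Q8 (w i)) [0..<k3]))"

lemma carrier_Z2: "carrier (integer_mod_group 2) = {0, 1}"
  by (auto simp: carrier_integer_mod_group)

lemma carrier_Z4: "carrier (integer_mod_group 4) = {0, 1, 2, 3}"
  by (auto simp: carrier_integer_mod_group)

lemmas gray_defs = gray_Z2_def gray_Z4_def gray_Q8_def

lemma length_gray_block:
  "x \<in> carrier (integer_mod_group 2) \<Longrightarrow> length (gray_Z2 x) = 1"
  "y \<in> carrier (integer_mod_group 4) \<Longrightarrow> length (gray_Z4 y) = 2"
  "w \<in> carrier Q8 \<Longrightarrow> length (gray_Q8 w) = 4"
  unfolding carrier_Z2 carrier_Z4 carrier_Q8 by (auto simp: gray_defs)

lemma gray_block_eq_chi:
  "x \<in> carrier (integer_mod_group 2) \<Longrightarrow> gray_Z2 x = map root_bit (chi_Z2 x)"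
  "y \<in> carrier (integer_mod_group 4) \<Longrightarrow> gray_Z4 y = map root_bit (chi_Z4 y)"
  "w \<in> carrier Q8 \<Longrightarrow> gray_Q8 w = map root_bit (chi_Q8 w)"
  unfolding carrier_Z2 carrier_Z4 carrier_Q8
  by (auto simp: gray_defs chi_Z2_def chi_Z4_def chi_Q8_def root_bit_def complex_eq_iff)

lemma inj_gray_block:
  "inj_on gray_Z2 (carrier (integer_mod_group 2))"
  "inj_on gray_Z4 (carrier (integer_mod_group 4))"
  "inj_on gray_Q8 (carrier Q8)"
  unfolding carrier_Z2 carrier_Z4 carrier_Q8 by (auto simp: gray_defs)

lemma set_chi_block:
  "set (chi_Z2 x) \<subseteq> fourth_roots" "set (chi_Z4 y) \<subseteq> fourth_roots"
  "set (chi_Q8 w) \<subseteq> fourth_roots"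
  by (auto simp: chi_Z2_def chi_Z4_def chi_Q8_def fourth_roots_def)

text \<open>An element of order 4 in Z4 or Q8 has as many zeros as ones in its Gray word, so both
  sides vanish; on all other elements the characters are real and are the signs themselves.\<close>

lemma sum_chi_block:
  "x \<in> carrier (integer_mod_group 2) \<Longrightarrow>
     sum_list (chi_Z2 x) = of_int (sum_list (map sgn_bit (gray_Z2 x)))"
  "y \<in> carrier (integer_mod_group 4) \<Longrightarrow>
     sum_list (chi_Z4 y) = of_int (sum_list (map sgn_bit (gray_Z4 y)))"
  "w \<in> carrier Q8 \<Longrightarrow>
     sum_list (chi_Q8 w) = of_int (sum_list (map sgn_bit (gray_Q8 w)))"
  unfolding carrier_Z2 carrier_Z4 carrier_Q8
  by (auto simp: gray_defs chi_Z2_def chi_Z4_def chi_Q8_def sgn_bit_def)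

lemma chi_block_mult:
  "x \<in> carrier (integer_mod_group 2) \<Longrightarrow> x' \<in> carrier (integer_mod_group 2) \<Longrightarrow>
     chi_Z2 (x \<otimes>\<^bsub>integer_mod_group 2\<^esub> x') = map2 (*) (chi_Z2 x) (chi_Z2 x')"
  "y \<in> carrier (integer_mod_group 4) \<Longrightarrow> y' \<in> carrier (integer_mod_group 4) \<Longrightarrow>
     chi_Z4 (y \<otimes>\<^bsub>integer_mod_group 4\<^esub> y') = map2 (*) (chi_Z4 y) (chi_Z4 y')"
  unfolding carrier_Z2 carrier_Z4
  by (auto simp: chi_Z2_def chi_Z4_def)

text \<open>Two commuting elements of Q8 lie in a common cyclic subgroup generated by some g of
  order 4, and there each coordinate is the character sending g to \<i> or -\<i>.\<close>

lemma chi_Q8_mult: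
  assumes "w \<in> carrier Q8" "w' \<in> carrier Q8" "w \<otimes>\<^bsub>Q8\<^esub> w' = w' \<otimes>\<^bsub>Q8\<^esub> w"
  shows "chi_Q8 (w \<otimes>\<^bsub>Q8\<^esub> w') = map2 (*) (chi_Q8 w) (chi_Q8 w')"
  using assms unfolding carrier_Q8
  by (elim insertE emptyE; simp add: chi_Q8_def gray_Q8_def Q8_def)

lemma map2_concat_map:
  assumes "\<And>i. i \<in> set xs \<Longrightarrow> length (F i) = length (G i)"
  shows "map2 f (concat (map F xs)) (concat (map G xs)) =
    concat (map (\<lambda>i. map2 f (F i) (G i)) xs)"
  using assms by (induction xs) auto

section \<open>Gray words and characters on the whole product group\<close>

lemma carrier_Z2Z4Q8:
  "((x, y), w) \<in> carrier (Z2Z4Q8_group k1 k2 k3) \<longleftrightarrow>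
     x \<in> (\<Pi>\<^sub>E i\<in>{..<k1}. carrier (integer_mod_group 2)) \<and>
     y \<in> (\<Pi>\<^sub>E i\<in>{..<k2}. carrier (integer_mod_group 4)) \<and>
     w \<in> (\<Pi>\<^sub>E i\<in>{..<k3}. carrier Q8)"
  by (simp add: Z2Z4Q8_group_def Z2Z4_group_def)

lemma mult_Z2Z4Q8:
  "((x, y), w) \<otimes>\<^bsub>Z2Z4Q8_group k1 k2 k3\<^esub> ((x', y'), w') =
     ((\<lambda>i\<in>{..<k1}. x i \<otimes>\<^bsub>integer_mod_group 2\<^esub> x' i,
       \<lambda>i\<in>{..<k2}. y i \<otimes>\<^bsub>integer_mod_group 4\<^esub> y' i), \<lambda>i\<in>{..<k3}. w i \<otimes>\<^bsub>Q8\<^esub> w' i)"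
  by (simp add: Z2Z4Q8_group_def Z2Z4_group_def)

lemma one_Z2Z4Q8:
  "\<one>\<^bsub>Z2Z4Q8_group k1 k2 k3\<^esub> = ((\<lambda>i\<in>{..<k1}. 0, \<lambda>i\<in>{..<k2}. 0), \<lambda>i\<in>{..<k3}. (0, 0))"
  by (simp add: Z2Z4Q8_group_def Z2Z4_group_def Q8_def)

lemma length_gray:
  assumes "g \<in> carrier (Z2Z4Q8_group k1 k2 k3)"
  shows "length (gray k1 k2 k3 g) = k1 + 2 * k2 + 4 * k3"
proof -
  obtain x y w where g: "g = ((x, y), w)" by (metis surj_pair)
  have blocks: "map (\<lambda>i. length (gray_Z2 (x i))) [0..<k1] = map (\<lambda>_. 1) [0..<k1]"
    "map (\<lambda>i. length (gray_Z4 (y i))) [0..<k2] = map (\<lambda>_. 2) [0..<k2]"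
    "map (\<lambda>i. length (gray_Q8 (w i))) [0..<k3] = map (\<lambda>_. 4) [0..<k3]"
    using assms unfolding g carrier_Z2Z4Q8
    by (auto intro!: length_gray_block[unfolded One_nat_def])
  show ?thesis
    by (simp add: g gray_def gray_Z2Z4_def length_concat comp_def blocks sum_list_triv
        del: map_eq_conv)
qed

lemma gray_eq_chi:
  assumes "g \<in> carrier (Z2Z4Q8_group k1 k2 k3)"
  shows "gray k1 k2 k3 g = map root_bit (chi k1 k2 k3 g)"
proof -
  obtain x y w where g: "g = ((x, y), w)" by (metis surj_pair)
  have blocks: "map (\<lambda>i. gray_Z2 (x i)) [0..<k1] = map (\<lambda>i. map root_bit (chi_Z2 (x i))) [0..<k1]"
    "map (\<lambda>i. gray_Z4 (y i)) [0..<k2] = map (\<lambda>i. map root_bit (chi_Z4 (y i))) [0..<k2]"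
    "map (\<lambda>i. gray_Q8 (w i)) [0..<k3] = map (\<lambda>i. map root_bit (chi_Q8 (w i))) [0..<k3]"
    using assms unfolding g carrier_Z2Z4Q8 by (auto intro!: gray_block_eq_chi)
  show ?thesis
    by (simp add: g gray_def gray_Z2Z4_def chi_def map_concat comp_def blocks del: map_eq_conv)
qed

lemma length_chi:
  assumes "g \<in> carrier (Z2Z4Q8_group k1 k2 k3)"
  shows "length (chi k1 k2 k3 g) = k1 + 2 * k2 + 4 * k3"
  using length_gray[OF assms] by (simp add: gray_eq_chi[OF assms])

lemma concat_map_inj:
  assumes "concat (map F xs) = concat (map G xs)"
    and "\<And>i. i \<in> set xs \<Longrightarrow> length (F i) = length (G i)" and "i \<in> set xs"
  shows "F i = G i"
  using assms by (induction xs) auto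

lemma inj_gray: "inj_on (gray k1 k2 k3) (carrier (Z2Z4Q8_group k1 k2 k3))"
proof (rule inj_onI)
  fix g h assume *: "g \<in> carrier (Z2Z4Q8_group k1 k2 k3)" "h \<in> carrier (Z2Z4Q8_group k1 k2 k3)"
    and eq: "gray k1 k2 k3 g = gray k1 k2 k3 h"
  obtain x y w where g: "g = ((x, y), w)" by (metis surj_pair)
  obtain x' y' w' where h: "h = ((x', y'), w')" by (metis surj_pair)
  note X = *[unfolded g h carrier_Z2Z4Q8]
  have car: "\<And>i. i < k1 \<Longrightarrow> x i \<in> carrier (integer_mod_group 2) \<and> x' i \<in> carrier (integer_mod_group 2)"
    "\<And>i. i < k2 \<Longrightarrow> y i \<in> carrier (integer_mod_group 4) \<and> y' i \<in> carrier (integer_mod_group 4)"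
    "\<And>i. i < k3 \<Longrightarrow> w i \<in> carrier Q8 \<and> w' i \<in> carrier Q8"
    using X by auto
  have len: "\<And>i. i \<in> set [0..<k1] \<Longrightarrow> length (gray_Z2 (x i)) = length (gray_Z2 (x' i))"
    "\<And>i. i \<in> set [0..<k2] \<Longrightarrow> length (gray_Z4 (y i)) = length (gray_Z4 (y' i))"
    "\<And>i. i \<in> set [0..<k3] \<Longrightarrow> length (gray_Q8 (w i)) = length (gray_Q8 (w' i))"
    using car by (simp_all add: length_gray_block)
  have len1: "length (concat (map (\<lambda>i. gray_Z2 (x i)) [0..<k1])) =
      length (concat (map (\<lambda>i. gray_Z2 (x' i)) [0..<k1]))"
    "length (concat (map (\<lambda>i. gray_Z4 (y i)) [0..<k2])) =
      length (concat (map (\<lambda>i. gray_Z4 (y' i)) [0..<k2]))"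
    unfolding length_concat map_map comp_def
    by (rule arg_cong[where f = sum_list], rule map_cong; simp add: len)+
  have c: "concat (map (\<lambda>i. gray_Z2 (x i)) [0..<k1]) = concat (map (\<lambda>i. gray_Z2 (x' i)) [0..<k1])"
    "concat (map (\<lambda>i. gray_Z4 (y i)) [0..<k2]) = concat (map (\<lambda>i. gray_Z4 (y' i)) [0..<k2])"
    "concat (map (\<lambda>i. gray_Q8 (w i)) [0..<k3]) = concat (map (\<lambda>i. gray_Q8 (w' i)) [0..<k3])"
    using eq len1 by (simp_all add: g h gray_def gray_Z2Z4_def)
  have x: "x i = x' i" if "i < k1" for i
    using concat_map_inj[OF c(1) len(1), of i] car(1) that inj_gray_block(1)
    by (simp add: inj_on_def)
  have y: "y i = y' i" if "i < k2" for i
    using concat_map_inj[OF c(2) len(2), of i] car(2) that inj_gray_block(2)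
    by (simp add: inj_on_def)
  have w: "w i = w' i" if "i < k3" for i
    using concat_map_inj[OF c(3) len(3), of i] car(3) that inj_gray_block(3)
    by (simp add: inj_on_def)
  have "x = x'" by (rule PiE_ext[OF X(1)[THEN conjunct1] X(2)[THEN conjunct1]]) (simp add: x)
  moreover have "y = y'"
    by (rule PiE_ext[OF X(1)[THEN conjunct2, THEN conjunct1] X(2)[THEN conjunct2, THEN conjunct1]])
      (simp add: y)
  moreover have "w = w'"
    by (rule PiE_ext[OF X(1)[THEN conjunct2, THEN conjunct2] X(2)[THEN conjunct2, THEN conjunct2]])
      (simp add: w)
  ultimately show "g = h"
    unfolding g h by simp
qed

lemma set_chi: "set (chi k1 k2 k3 g) \<subseteq> fourth_roots"
proof -
  obtain x y w where g: "g = ((x, y), w)" by (metis surj_pair)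
  show ?thesis
    unfolding g chi_def using set_chi_block by (simp add: UN_subset_iff)
qed

lemma sum_list_concat_map:
  "sum_list (concat (map F xs)) = (\<Sum>i\<leftarrow>xs. sum_list (F i))"
  by (induction xs) auto

lemma sum_chi:
  assumes "g \<in> carrier (Z2Z4Q8_group k1 k2 k3)"
  shows "sum_list (chi k1 k2 k3 g) = of_int (sum_list (map sgn_bit (gray k1 k2 k3 g)))"
proof -
  obtain x y w where g: "g = ((x, y), w)" by (metis surj_pair)
  have blocks: "map (\<lambda>i. sum_list (chi_Z2 (x i))) [0..<k1] =
      map (\<lambda>i. of_int (sum_list (map sgn_bit (gray_Z2 (x i))))) [0..<k1]"
    "map (\<lambda>i. sum_list (chi_Z4 (y i))) [0..<k2] =
      map (\<lambda>i. of_int (sum_list (map sgn_bit (gray_Z4 (y i))))) [0..<k2]"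
    "map (\<lambda>i. sum_list (chi_Q8 (w i))) [0..<k3] =
      map (\<lambda>i. of_int (sum_list (map sgn_bit (gray_Q8 (w i))))) [0..<k3]"
    using assms unfolding g carrier_Z2Z4Q8
    by (auto intro!: sum_chi_block)
  have "of_int (sum_list (map f xs)) = (\<Sum>i\<leftarrow>xs. of_int (f i) :: complex)"
    for f :: "nat \<Rightarrow> int" and xs by (induction xs) auto
  then show ?thesis
    by (simp add: g gray_def gray_Z2Z4_def chi_def sum_list_concat_map map_concat comp_def blocks
        del: map_eq_conv)
qed

lemma chi_mult:
  assumes g: "g \<in> carrier (Z2Z4Q8_group k1 k2 k3)" and h: "h \<in> carrier (Z2Z4Q8_group k1 k2 k3)"
    and comm: "g \<otimes>\<^bsub>Z2Z4Q8_group k1 k2 k3\<^esub> h = h \<otimes>\<^bsub>Z2Z4Q8_group k1 k2 k3\<^esub> g"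
  shows "chi k1 k2 k3 (g \<otimes>\<^bsub>Z2Z4Q8_group k1 k2 k3\<^esub> h) =
    map2 (*) (chi k1 k2 k3 g) (chi k1 k2 k3 h)"
proof -
  obtain x y w where g': "g = ((x, y), w)" by (metis surj_pair)
  obtain x' y' w' where h': "h = ((x', y'), w')" by (metis surj_pair)
  have car: "\<And>i. i < k1 \<Longrightarrow> x i \<in> carrier (integer_mod_group 2) \<and> x' i \<in> carrier (integer_mod_group 2)"
    "\<And>i. i < k2 \<Longrightarrow> y i \<in> carrier (integer_mod_group 4) \<and> y' i \<in> carrier (integer_mod_group 4)"
    "\<And>i. i < k3 \<Longrightarrow> w i \<in> carrier Q8 \<and> w' i \<in> carrier Q8"
    using g h unfolding g' h' carrier_Z2Z4Q8 by auto
  have cw: "w i \<otimes>\<^bsub>Q8\<^esub> w' i = w' i \<otimes>\<^bsub>Q8\<^esub> w i" if "i < k3" for i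
  proof -
    have "(\<lambda>i\<in>{..<k3}. w i \<otimes>\<^bsub>Q8\<^esub> w' i) = (\<lambda>i\<in>{..<k3}. w' i \<otimes>\<^bsub>Q8\<^esub> w i)"
      using comm unfolding g' h' mult_Z2Z4Q8 by simp
    from fun_cong[OF this, of i] that show ?thesis by simp
  qed
  have m: "concat (map (\<lambda>i. chi_Z2 ((\<lambda>i\<in>{..<k1}. x i \<otimes>\<^bsub>integer_mod_group 2\<^esub> x' i) i)) [0..<k1]) =
      concat (map (\<lambda>i. map2 (*) (chi_Z2 (x i)) (chi_Z2 (x' i))) [0..<k1])"
    "concat (map (\<lambda>i. chi_Z4 ((\<lambda>i\<in>{..<k2}. y i \<otimes>\<^bsub>integer_mod_group 4\<^esub> y' i) i)) [0..<k2]) =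
      concat (map (\<lambda>i. map2 (*) (chi_Z4 (y i)) (chi_Z4 (y' i))) [0..<k2])"
    "concat (map (\<lambda>i. chi_Q8 ((\<lambda>i\<in>{..<k3}. w i \<otimes>\<^bsub>Q8\<^esub> w' i) i)) [0..<k3]) =
      concat (map (\<lambda>i. map2 (*) (chi_Q8 (w i)) (chi_Q8 (w' i))) [0..<k3])"
    using car
    by (auto intro!: arg_cong[where f = concat]
        simp: chi_block_mult chi_Q8_mult[OF _ _ cw] simp del: mult_integer_mod_group)
  have len: "length (chi_Z2 a) = 1" "length (chi_Z4 a) = 2" for a
    by (auto simp: chi_Z2_def chi_Z4_def)
  have len8: "length (chi_Q8 a) = 4" if "a \<in> carrier Q8" for a
    using length_gray_block(3)[OF that] by (auto simp: chi_Q8_def)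
  have lc: "length (concat (map (\<lambda>i. chi_Z2 (x i)) [0..<k1])) =
      length (concat (map (\<lambda>i. chi_Z2 (x' i)) [0..<k1]))"
    "length (concat (map (\<lambda>i. chi_Z4 (y i)) [0..<k2])) =
      length (concat (map (\<lambda>i. chi_Z4 (y' i)) [0..<k2]))"
    by (simp_all add: length_concat len comp_def)
  have q: "map2 (*) (concat (map (\<lambda>i. chi_Q8 (w i)) [0..<k3])) (concat (map (\<lambda>i. chi_Q8 (w' i)) [0..<k3])) =
      concat (map (\<lambda>i. map2 (*) (chi_Q8 (w i)) (chi_Q8 (w' i))) [0..<k3])"
    by (rule map2_concat_map) (use car(3) in \<open>simp add: len8\<close>)
  show ?thesis
    unfolding g' h' mult_Z2Z4Q8 unfolding chi_def prod.case m
    using lc by (simp add: map2_concat_map len q)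
qed

lemma chi_one: "chi k1 k2 k3 \<one>\<^bsub>Z2Z4Q8_group k1 k2 k3\<^esub> = replicate (k1 + 2 * k2 + 4 * k3) 1"
proof -
  have "\<forall>c\<in>set (chi k1 k2 k3 \<one>\<^bsub>Z2Z4Q8_group k1 k2 k3\<^esub>). c = 1"
    unfolding one_Z2Z4Q8 by (auto simp: chi_def chi_Z2_def chi_Z4_def chi_Q8_def)
  then show ?thesis
    by (metis group.is_monoid group_Z2Z4Q8 length_chi monoid.one_closed replicate_length_same)
qed

lemma qa_square: "qa [^]\<^bsub>Q8\<^esub> (2::nat) = (2, 0)"
  by (simp add: numeral_eq_Suc nat_pow_def Q8_def qa_def)

lemma u_elem_closed: "u_elem k1 k2 k3 \<in> carrier (Z2Z4Q8_group k1 k2 k3)"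
  unfolding u_elem_def carrier_Z2Z4Q8 qa_square carrier_Z2 carrier_Z4 carrier_Q8 by auto

lemma chi_u: "chi k1 k2 k3 (u_elem k1 k2 k3) = replicate (k1 + 2 * k2 + 4 * k3) (- 1)"
proof -
  have "\<forall>c\<in>set (chi k1 k2 k3 (u_elem k1 k2 k3)). c = - 1"
    unfolding u_elem_def qa_square by (auto simp: chi_def chi_Z2_def chi_Z4_def chi_Q8_def)
  then show ?thesis
    by (metis length_chi u_elem_closed replicate_length_same)
qed

section \<open>Squares, commutators and involutions of Q8\<close>

lemma Q8_square_square:
  assumes "w \<in> carrier Q8"
  shows "(w \<otimes>\<^bsub>Q8\<^esub> w) \<otimes>\<^bsub>Q8\<^esub> (w \<otimes>\<^bsub>Q8\<^esub> w) = (0, 0)"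
  using assms unfolding carrier_Q8
  by (elim insertE emptyE; simp add: Q8_def)

text \<open>The commutator subgroup of Q8 is {1, a^2}.\<close>

lemma Q8_swap_up_to_involution:
  assumes "w \<in> carrier Q8" "w' \<in> carrier Q8"
  shows "w \<otimes>\<^bsub>Q8\<^esub> w' = w' \<otimes>\<^bsub>Q8\<^esub> w \<or> w \<otimes>\<^bsub>Q8\<^esub> w' = (2, 0) \<otimes>\<^bsub>Q8\<^esub> (w' \<otimes>\<^bsub>Q8\<^esub> w)"
  using assms unfolding carrier_Q8
  by (elim insertE emptyE; simp add: Q8_def)

text \<open>Only 1 and a^2 have trivial square, and both are central.\<close>

lemma Q8_involution_central:
  assumes "w \<in> carrier Q8" "w' \<in> carrier Q8" "w \<otimes>\<^bsub>Q8\<^esub> w = (0, 0)"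
  shows "w \<otimes>\<^bsub>Q8\<^esub> w' = w' \<otimes>\<^bsub>Q8\<^esub> w"
  using assms unfolding carrier_Q8
  by (elim insertE emptyE; simp add: Q8_def)

section \<open>Hadamard codes by correlations\<close>

text \<open>Inner product of the associated rows of signs; for words of equal length it is the
  length minus twice the Hamming distance.\<close>

definition corr :: "bit list \<Rightarrow> bit list \<Rightarrow> int" where
  "corr v w = (\<Sum>i<length v. sgn_bit (v ! i) * sgn_bit (w ! i))"

definition complement :: "bit list \<Rightarrow> bit list" where
  "complement v = map (\<lambda>c. 1 + c) v"

lemma bit_cases: "b = 0 \<or> b = (1::bit)"
  by (cases b) auto

lemma sgn_bit_simps [simp]:
  "sgn_bit 0 = 1" "sgn_bit 1 = - 1" "sgn_bit b * sgn_bit b = 1"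
  by (auto simp: sgn_bit_def)

lemma length_complement [simp]: "length (complement v) = length v"
  by (simp add: complement_def)

lemma complement_complement [simp]: "complement (complement v) = v"
proof -
  have "1 + (1 + b) = b" for b :: bit
    using bit_cases[of b] by auto
  then show ?thesis
    unfolding complement_def map_map comp_def by (metis map_idI)
qed

lemma inj_complement: "inj_on complement X"
  by (metis complement_complement inj_onI)

lemma complement_replicate: "complement (replicate n 0) = replicate n 1"
  by (simp add: complement_def)

lemma sgn_bit_complement:
  assumes "i < length v"
  shows "sgn_bit (complement v ! i) = - sgn_bit (v ! i)"
  using assms bit_cases[of "v ! i"] by (auto simp: complement_def sgn_bit_def)

lemma complement_nth_eq_0_iff:
  assumes "i < length v"
  shows "complement v ! i = 0 \<longleftrightarrow> v ! i = 1"
  using assms bit_cases[of "v ! i"] by (auto simp: complement_def)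

lemma corr_self: "corr v v = int (length v)"
  by (simp add: corr_def)

lemma corr_complement:
  assumes "length w = length v"
  shows "corr (complement v) w = - corr v w" "corr v (complement w) = - corr v w"
  using assms by (simp_all add: corr_def sgn_bit_complement sum_negf)

text \<open>Everything comes from H H^T = n I. Equal rows would have correlation n and complementary
  rows -n, so the n rows and their complements are 2n distinct words; the two constant words come
  from the normalized first row.\<close>

lemma hadamard_codeD:
  assumes "hadamard_code n K"
  shows "0 < n" "card K = 2 * n" "\<And>v. v \<in> K \<Longrightarrow> length v = n" "replicate n 0 \<in> K"
    "replicate n 1 \<in> K"
    "\<And>v w. v \<in> K \<Longrightarrow> w \<in> K \<Longrightarrow> v = w \<or> w = complement v \<or> corr v w = 0"
proof -
  obtain H where H: "normalized_hadamard_matrix n H"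
    and K: "K = (\<lambda>i. list_of_vec (row (binary_mat H) i)) ` {..<n} \<union>
      complement ` (\<lambda>i. list_of_vec (row (binary_mat H) i)) ` {..<n}"
    using assms unfolding hadamard_code_def Let_def complement_def[abs_def, symmetric] by auto
  define R where "R i = list_of_vec (row (binary_mat H) i)" for i
  have K': "K = R ` {..<n} \<union> complement ` R ` {..<n}"
    unfolding K R_def[abs_def] ..
  have n: "0 < n" and dim: "H \<in> carrier_mat n n"
    and pm: "\<And>i j. i < n \<Longrightarrow> j < n \<Longrightarrow> H $$ (i, j) = 1 \<or> H $$ (i, j) = - 1"
    and orth: "H * transpose_mat H = int n \<cdot>\<^sub>m 1\<^sub>m n"
    and first: "\<And>j. j < n \<Longrightarrow> H $$ (0, j) = 1"
    using H unfolding normalized_hadamard_matrix_def hadamard_matrix_def by auto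
  show "0 < n" by fact
  have lenR: "length (R i) = n" for i
    using dim by (simp add: R_def binary_mat_def)
  have sgR: "sgn_bit (R i ! j) = H $$ (i, j)" if "i < n" "j < n" for i j
    using dim that pm[OF that] by (auto simp: R_def binary_mat_def list_of_vec_index)
  have corrR: "corr (R i) (R j) = (if i = j then int n else 0)" if "i < n" "j < n" for i j
  proof -
    have "corr (R i) (R j) = (\<Sum>k<n. H $$ (i, k) * H $$ (j, k))"
      unfolding corr_def lenR using that by (simp add: sgR)
    also have "\<dots> = (H * transpose_mat H) $$ (i, j)"
      using dim that by (auto simp: scalar_prod_def lessThan_atLeast0 intro!: sum.cong)
    finally show ?thesis unfolding orth using that by simp
  qed
  have lenK: "length v = n" if "v \<in> K" for v
    using that lenR unfolding K' by auto
  then show "\<And>v. v \<in> K \<Longrightarrow> length v = n" .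
  have R0: "R 0 = replicate n 0"
  proof (rule nth_equalityI)
    fix i assume "i < length (R 0)"
    then have "sgn_bit (R 0 ! i) = 1" using n by (simp add: lenR sgR first)
    then show "R 0 ! i = replicate n 0 ! i"
      using \<open>i < length (R 0)\<close> bit_cases[of "R 0 ! i"] by (auto simp: lenR)
  qed (simp add: lenR)
  then show "replicate n 0 \<in> K" using n unfolding K' by force
  have "complement (R 0) \<in> K" using n unfolding K' by blast
  then show "replicate n 1 \<in> K" by (simp add: R0 complement_replicate)
  have inj: "inj_on R {..<n}"
  proof (rule inj_onI)
    fix i j assume "i \<in> {..<n}" "j \<in> {..<n}" "R i = R j"
    then show "i = j" using corrR[of i j] corrR[of i i] n by (auto split: if_splits)
  qed
  have compl: "R i \<noteq> complement (R j)" if "i < n" "j < n" for i j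
  proof
    assume eq: "R i = complement (R j)"
    have "corr (R i) (R j) = - int n"
      unfolding eq by (subst corr_complement) (simp_all add: corr_self lenR)
    then show False using corrR[OF that] n by (auto split: if_splits)
  qed
  have "card K = card (R ` {..<n}) + card (complement ` R ` {..<n})"
    unfolding K' by (intro card_Un_disjoint) (use compl in auto)
  also have "\<dots> = 2 * n"
    by (simp add: card_image[OF inj_complement] card_image[OF inj])
  finally show "card K = 2 * n" .
  show "v = w \<or> w = complement v \<or> corr v w = 0" if v: "v \<in> K" and w: "w \<in> K" for v w
  proof -
    obtain i where i: "i < n" "v = R i \<or> v = complement (R i)" using v unfolding K' by auto
    obtain j where j: "j < n" "w = R j \<or> w = complement (R j)" using w unfolding K' by auto
    show ?thesis
    proof (cases "i = j")
      case True
      then show ?thesis using i(2) j(2) complement_complement by metis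
    next
      case False
      have "corr v w = 0"
        using i j corrR[OF i(1) j(1)] False by (auto simp: corr_complement lenR)
      then show ?thesis by simp
    qed
  qed
qed

text \<open>A converse to the extraction above, with closure under complement in place of a matrix:
  one word of each complementary pair serves as a row.\<close>

lemma hadamard_codeI:
  assumes n: "0 < n" and card: "card K = 2 * n" and len: "\<And>v. v \<in> K \<Longrightarrow> length v = n"
    and zero: "replicate n 0 \<in> K" and compl: "\<And>v. v \<in> K \<Longrightarrow> complement v \<in> K"
    and orth: "\<And>v w. v \<in> K \<Longrightarrow> w \<in> K \<Longrightarrow> v = w \<or> w = complement v \<or> corr v w = 0"
  shows "hadamard_code n K"
proof -
  \<comment> \<open>Exactly one of \<open>v\<close> and \<open>complement v\<close> begins with 0,
    so \<open>S\<close> contains one word of each pair, and the first column of signs is constantly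
    1.\<close>
  define S where "S = {v \<in> K. v ! 0 = 0}"
  have finK: "finite K" using card n by (metis card.infinite mult_eq_0_iff not_less0 zero_neq_numeral)
  then have finS: "finite S" by (simp add: S_def)
  have KS: "K = S \<union> complement ` S"
  proof
    show "K \<subseteq> S \<union> complement ` S"
    proof
      fix v assume v: "v \<in> K"
      show "v \<in> S \<union> complement ` S"
      proof (cases "v ! 0 = 0")
        case False
        then have "complement v ! 0 = 0"
          using bit_cases[of "v ! 0"] len[OF v] n by (simp add: complement_nth_eq_0_iff)
        then have "complement v \<in> S" using compl[OF v] by (simp add: S_def)
        then show ?thesis by (metis UnI2 complement_complement image_eqI)
      qed (use v in \<open>simp add: S_def\<close>)
    qed
  qed (use compl in \<open>auto simp: S_def\<close>)
  have hd1: "complement v ! 0 \<noteq> 0" if "v \<in> S" for v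
    using that len n by (auto simp: S_def complement_nth_eq_0_iff)
  have "S \<inter> complement ` S = {}"
    using hd1 by (force simp: S_def)
  then have "card K = card S + card S"
    using finS by (subst KS, subst card_Un_disjoint) (simp_all add: card_image[OF inj_complement])
  then have cS: "card S = n" using card by simp
  have zS: "replicate n 0 \<in> S" using zero n by (simp add: S_def)
  have "\<exists>xs. set xs = S - {replicate n 0} \<and> distinct xs"
    using finS by (intro finite_distinct_list) simp
  then obtain xs where xs: "set xs = S - {replicate n 0}" "distinct xs" by auto
  \<comment> \<open>The zero word is put first so that row 0 of the matrix is constantly 1.\<close>
  define L where "L = replicate n 0 # xs"
  have L: "set L = S" "distinct L" using xs zS by (auto simp: L_def)
  have lenL: "length L = n" using L cS by (metis distinct_card)
  have L0: "L ! 0 = replicate n 0" by (simp add: L_def)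
  have Li: "L ! i \<in> S" if "i < n" for i using that L(1) lenL nth_mem by blast
  have lenLi: "length (L ! i) = n" if "i < n" for i using Li[OF that] len by (auto simp: S_def)
  define H where "H = mat n n (\<lambda>(i, j). sgn_bit (L ! i ! j))"
  have corrL: "corr (L ! i) (L ! j) = (if i = j then int n else 0)" if "i < n" "j < n" for i j
  proof (cases "i = j")
    case False
    then have "L ! i \<noteq> L ! j" using L(2) that lenL by (simp add: nth_eq_iff_index_eq)
    moreover have "L ! j \<noteq> complement (L ! i)"
      using Li[OF that(1)] Li[OF that(2)] hd1 by (force simp: S_def)
    ultimately show ?thesis
      using orth[of "L ! i" "L ! j"] Li[OF that(1)] Li[OF that(2)] False by (auto simp: S_def)
  qed (simp add: corr_self lenLi that)
  have "H * transpose_mat H = int n \<cdot>\<^sub>m 1\<^sub>m n"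
  proof (rule eq_matI)
    fix i j assume "i < dim_row (int n \<cdot>\<^sub>m 1\<^sub>m n)" "j < dim_col (int n \<cdot>\<^sub>m 1\<^sub>m n)"
    then have ij: "i < n" "j < n" by auto
    have "(H * transpose_mat H) $$ (i, j) = corr (L ! i) (L ! j)"
      using ij by (auto simp: H_def corr_def lenLi scalar_prod_def lessThan_atLeast0 intro!: sum.cong)
    then show "(H * transpose_mat H) $$ (i, j) = (int n \<cdot>\<^sub>m 1\<^sub>m n) $$ (i, j)"
      using ij corrL by simp
  qed (simp_all add: H_def)
  then have "normalized_hadamard_matrix n H"
    using n Li by (auto simp: normalized_hadamard_matrix_def hadamard_matrix_def H_def L0 sgn_bit_def
        S_def)
  moreover have "(\<lambda>i. list_of_vec (row (binary_mat H) i)) ` {..<n} = S"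
  proof -
    have "list_of_vec (row (binary_mat H) i) = L ! i" if "i < n" for i
      by (rule nth_equalityI)
        (use that bit_cases in \<open>auto simp: binary_mat_def H_def lenLi list_of_vec_index sgn_bit_def\<close>)
    then have "(\<lambda>i. list_of_vec (row (binary_mat H) i)) ` {..<n} = (!) L ` {..<n}" by simp
    also have "\<dots> = S" using L(1) lenL by (metis atLeast_upt set_map map_nth)
    finally show ?thesis .
  qed
  ultimately show ?thesis
    unfolding hadamard_code_def Let_def complement_def[abs_def, symmetric] using KS by (intro exI[of _ H]) simp
qed

section \<open>Codes from balanced families of characters\<close>

lemma nth_concat_replicate:
  assumes "l < r * length v"
  shows "concat (replicate r v) ! l = v ! (l mod length v)"
  using assms
proof (induction r arbitrary: l)
  case (Suc r)
  show ?case
  proof (cases "l < length v")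
    case False
    then show ?thesis using Suc.IH[of "l - length v"] Suc.prems
      by (simp add: nth_append le_mod_geq)
  qed (simp add: nth_append)
qed simp

lemma length_concat_replicate: "length (concat (replicate r v)) = r * length v"
  by (induction r) auto

section \<open>Uniform fibres, permutations and pairings\<close>

text \<open>The sum is grouped by the value of \<open>c\<close>. The case F = 1 gives n = r * length
  qs; products of signs give the comparison of correlations.\<close>

lemma sum_uniform_fibres:
  fixes F :: "'b \<Rightarrow> 'c::semiring_1" and c :: "nat \<Rightarrow> 'b"
  assumes "distinct qs" and c: "\<And>p. p < n \<Longrightarrow> c p \<in> set qs"
    and r: "\<And>q. q \<in> set qs \<Longrightarrow> card {p. p < n \<and> c p = q} = r"
  shows "(\<Sum>p<n. F (c p)) = of_nat r * (\<Sum>i<length qs. F (qs ! i))"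
proof -
  have "(\<Sum>p<n. F (c p)) = (\<Sum>q\<in>set qs. \<Sum>p | p \<in> {..<n} \<and> c p = q. F (c p))"
    by (rule sum.group[symmetric]) (use c in auto)
  also have "\<dots> = (\<Sum>q\<in>set qs. of_nat r * F q)"
    by (rule sum.cong) (simp_all add: r)
  also have "\<dots> = (\<Sum>i<length qs. of_nat r * F (qs ! i))"
    by (rule sum.reindex_bij_betw[symmetric], rule bij_betw_nth) (use assms(1) in auto)
  finally show ?thesis by (simp add: sum_distrib_left)
qed

text \<open>The r positions of each fibre are numbered. The position with number j and value
  \<open>qs ! i\<close> is sent to j * N + i, the place of entry i in copy j of the repeated word;
  quotient and remainder by N recover j and i.\<close>

lemma uniform_fibres_permutation:
  fixes c :: "nat \<Rightarrow> 'b"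
  assumes dist: "distinct qs" and c: "\<And>p. p < n \<Longrightarrow> c p \<in> set qs"
    and r: "\<And>q. q \<in> set qs \<Longrightarrow> card {p. p < n \<and> c p = q} = r"
  obtains \<pi> where "\<pi> permutes {..<n}" "\<And>p. p < n \<Longrightarrow> qs ! (\<pi> p mod length qs) = c p"
proof -
  define N where "N = length qs"
  have n: "n = r * N"
    using sum_uniform_fibres[OF assms, where F = "\<lambda>_. 1::nat"] by (simp add: N_def)
  have "\<exists>\<beta>. bij_betw \<beta> {p. p < n \<and> c p = q} {..<r}" if "q \<in> set qs" for q
    using ex_bij_betw_finite_nat[of "{p. p < n \<and> c p = q}"] r[OF that]
    by (auto simp: lessThan_atLeast0)
  then obtain \<beta> where \<beta>: "\<And>q. q \<in> set qs \<Longrightarrow> bij_betw (\<beta> q) {p. p < n \<and> c p = q} {..<r}"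
    by metis
  have "\<exists>i. i < N \<and> qs ! i = c p" if "p < n" for p
    using c[OF that] by (simp add: in_set_conv_nth N_def)
  then obtain ix where ix: "\<And>p. p < n \<Longrightarrow> ix p < N \<and> qs ! ix p = c p" by metis
  \<comment> \<open>Outside \<open>{..<n}\<close> the map is the identity, as
    \<open>permutes\<close> demands.\<close>
  define \<pi> where "\<pi> p = (if p < n then \<beta> (c p) p * N + ix p else p)" for p
  have \<pi>mod: "\<pi> p mod N = ix p" and \<pi>div: "\<pi> p div N = \<beta> (c p) p" if "p < n" for p
    using ix[OF that] that by (auto simp: \<pi>_def)
  have \<beta>less: "\<beta> (c p) p < r" if "p < n" for p
    using bij_betwE[OF \<beta>[OF c[OF that]]] that by auto
  have inj: "inj_on \<pi> {..<n}"
  proof (rule inj_onI)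
    fix p q assume pq: "p \<in> {..<n}" "q \<in> {..<n}" "\<pi> p = \<pi> q"
    then have "c p = c q" using \<pi>mod ix by (metis lessThan_iff)
    moreover from this have "\<beta> (c p) p = \<beta> (c p) q" using \<pi>div pq by (metis lessThan_iff)
    ultimately show "p = q"
      using bij_betw_imp_inj_on[OF \<beta>[OF c[of p]]] pq by (auto simp: inj_on_def)
  qed
  have "\<pi> p < n" if "p < n" for p
  proof -
    have "\<pi> p < \<beta> (c p) p * N + N" using that ix[OF that] by (simp add: \<pi>_def)
    also have "\<dots> = Suc (\<beta> (c p) p) * N" by simp
    also have "\<dots> \<le> r * N" using \<beta>less[OF that] by (intro mult_le_mono1) simp
    finally show ?thesis by (simp add: n)
  qed
  then have "\<pi> ` {..<n} = {..<n}"
    using inj by (intro endo_inj_surj) auto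
  then have "bij_betw \<pi> {..<n} {..<n}" using inj by (simp add: bij_betw_def)
  then have "\<pi> permutes {..<n}" by (rule bij_imp_permutes) (simp add: \<pi>_def)
  moreover have "qs ! (\<pi> p mod length qs) = c p" if "p < n" for p
    using \<pi>mod[OF that] ix[OF that] by (simp add: N_def)
  ultimately show thesis by (rule that)
qed

text \<open>One pair {x, f x} is removed at a time; the rest stays closed because f is injective on
  S. Listing \<open>f y\<close> before \<open>y\<close> fits the Gray order of a conjugate
  pair.\<close>

lemma involution_pairing:
  assumes "finite S" and "\<And>x. x \<in> S \<Longrightarrow> f x \<in> S" and "\<And>x. x \<in> S \<Longrightarrow> f (f x) = x"
    and "\<And>x. x \<in> S \<Longrightarrow> f x \<noteq> x"
  shows "\<exists>ys. distinct (concat (map (\<lambda>y. [f y, y]) ys)) \<and> set (concat (map (\<lambda>y. [f y, y]) ys)) = S"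
  using assms
proof (induction S rule: finite_psubset_induct)
  case (psubset S)
  show ?case
  proof (cases "S = {}")
    case True
    then show ?thesis by (intro exI[of _ "[]"]) simp
  next
    case False
    then obtain x where x: "x \<in> S" by blast
    let ?S = "S - {x, f x}"
    have fx: "f x \<in> S" "f (f x) = x" "f x \<noteq> x" using psubset.prems x by auto
    have "\<exists>ys. distinct (concat (map (\<lambda>y. [f y, y]) ys)) \<and>
        set (concat (map (\<lambda>y. [f y, y]) ys)) = ?S"
    proof (rule psubset.IH)
      show "?S \<subset> S" using x by blast
      show "f y \<in> ?S" if "y \<in> ?S" for y
      proof -
        have "f y \<noteq> x" "f y \<noteq> f x" using that psubset.prems(2)[of y] fx by auto
        then show ?thesis using that psubset.prems(1)[of y] by auto
      qed
    qed (use psubset.prems in auto)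
    then obtain ys where "distinct (concat (map (\<lambda>y. [f y, y]) ys))"
      "set (concat (map (\<lambda>y. [f y, y]) ys)) = ?S" by blast
    then show ?thesis
      using x fx by (intro exI[of _ "x # ys"]) auto
  qed
qed

section \<open>Fourth roots of unity as exponents\<close>

definition root_log2 :: "complex \<Rightarrow> int" where
  "root_log2 w = (if w = 1 then 0 else 1)"

definition root_log4 :: "complex \<Rightarrow> int" where
  "root_log4 w = (if w = 1 then 0 else if w = \<i> then 1 else if w = - 1 then 2 else 3)"

text \<open>The fifth fact lets a conjugate pair of characters become one Z4-coordinate: the Gray
  image of the exponent consists of the two bits. The fourth makes multiplication by
  \<open>u\<close>, where every character is -1, complement the word.\<close>

lemma fourth_root_facts:
  assumes "w \<in> fourth_roots"
  shows "w * cnj w = 1" "w \<noteq> 0" "cnj w \<in> fourth_roots" "root_bit (- w) = 1 + root_bit w"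
    "gray_Z4 (root_log4 w) = [root_bit (cnj w), root_bit w]"
    "root_log4 w \<in> carrier (integer_mod_group 4)"
  using assms unfolding carrier_Z4
  by (auto simp: fourth_roots_def root_bit_def root_log4_def gray_Z4_def complex_eq_iff)

lemma root_log2_facts:
  assumes "w = 1 \<or> w = - 1"
  shows "gray_Z2 (root_log2 w) = [root_bit w]" "root_log2 w \<in> carrier (integer_mod_group 2)"
  using assms unfolding carrier_Z2
  by (auto simp: root_bit_def root_log2_def gray_Z2_def complex_eq_iff)

lemma root_log2_mult:
  assumes "w = 1 \<or> w = - 1" "w' = 1 \<or> w' = - 1"
  shows "root_log2 (w * w') = root_log2 w \<otimes>\<^bsub>integer_mod_group 2\<^esub> root_log2 w'"
  using assms by (auto simp: root_log2_def)

lemma root_log4_mult: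
  assumes "w \<in> fourth_roots" "w' \<in> fourth_roots"
  shows "root_log4 (w * w') = root_log4 w \<otimes>\<^bsub>integer_mod_group 4\<^esub> root_log4 w'"
  using assms by (auto simp: fourth_roots_def root_log4_def complex_eq_iff)

section \<open>Character sums and multiplicities\<close>

lemma (in group) sum_nontrivial_character:
  fixes \<phi> :: "'a \<Rightarrow> complex"
  assumes A: "subgroup A G"
    and mult: "\<And>g h. g \<in> A \<Longrightarrow> h \<in> A \<Longrightarrow> \<phi> (g \<otimes> h) = \<phi> g * \<phi> h"
    and h: "h \<in> A" "\<phi> h \<noteq> 1"
  shows "(\<Sum>g\<in>A. \<phi> g) = 0"
proof -
  have car: "g \<in> carrier G" if "g \<in> A" for g using A that by (rule subgroup.mem_carrier)
  \<comment> \<open>Translation by h permutes A and multiplies the sum by the factor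
    \<open>\<phi> h\<close>, which is not 1.\<close>
  have "bij_betw ((\<otimes>) h) A A"
  proof (rule bij_betwI[where g = "\<lambda>g. inv h \<otimes> g"])
    show "(\<otimes>) h \<in> A \<rightarrow> A" using A h(1) by (auto intro: subgroup.m_closed)
    show "(\<otimes>) (inv h) \<in> A \<rightarrow> A"
      using A h(1) by (auto intro!: subgroup.m_closed subgroup.m_inv_closed)
  qed (use car h(1) in \<open>simp_all flip: m_assoc\<close>)
  then have "(\<Sum>g\<in>A. \<phi> g) = (\<Sum>g\<in>A. \<phi> (h \<otimes> g))"
    by (rule sum.reindex_bij_betw[symmetric])
  also have "\<dots> = \<phi> h * (\<Sum>g\<in>A. \<phi> g)"
    using h(1) by (simp add: mult sum_distrib_left)
  finally show ?thesis using h(2) by simp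
qed

text \<open>The setting freed from the Gray map: n is the length, r the multiplicity to be
  established, and \<open>\<chi>\<close> a list of characters of \<open>A\<close> that may repeat.
  The Hadamard property enters through \<open>sum_chars\<close> and \<open>card_A\<close>.\<close>

locale hadamard_characters = group G for G (structure) +
  fixes A :: "'a set" and u :: 'a and n r :: nat and \<chi> :: "nat \<Rightarrow> 'a \<Rightarrow> complex"
  assumes A: "subgroup A G" and finite_A: "finite A" and u: "u \<in> A" "u \<noteq> \<one>"
    and root: "\<And>p g. p < n \<Longrightarrow> g \<in> A \<Longrightarrow> \<chi> p g \<in> fourth_roots"
    and mult: "\<And>p g h. p < n \<Longrightarrow> g \<in> A \<Longrightarrow> h \<in> A \<Longrightarrow> \<chi> p (g \<otimes> h) = \<chi> p g * \<chi> p h"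
    and chi_at_u: "\<And>p. p < n \<Longrightarrow> \<chi> p u = - 1"
    and sum_chars: "\<And>g. g \<in> A \<Longrightarrow>
      (\<Sum>p<n. \<chi> p g) = (if g = \<one> then of_nat n else if g = u then - of_nat n else 0)"
    and card_A: "r * card A = 2 * n" and n_pos: "0 < n"
begin

text \<open>Restriction makes two indices contribute the same element exactly when their characters
  agree on \<open>A\<close>.\<close>

definition chars :: "('a \<Rightarrow> complex) set" where
  "chars = (\<lambda>p. restrict (\<chi> p) A) ` {..<n}"

definition conj_char :: "('a \<Rightarrow> complex) \<Rightarrow> 'a \<Rightarrow> complex" where
  "conj_char \<psi> = (\<lambda>g\<in>A. cnj (\<psi> g))"

lemma r_pos: "0 < r"
  using card_A n_pos by (cases r) auto

lemma card_A_pos: "0 < card A"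
  using card_A n_pos by (cases "card A") auto

text \<open>By orthogonality the number of indices \<open>p\<close> with \<open>\<chi> p = \<psi>\<close> is the inner product of
  \<open>\<psi>\<close> with the sum of all \<open>\<chi> p\<close>, which is supported on \<open>{\<one>, u}\<close>.\<close>

lemma multiplicity:
  assumes mult\<psi>: "\<And>g h. g \<in> A \<Longrightarrow> h \<in> A \<Longrightarrow> \<psi> (g \<otimes> h) = \<psi> g * \<psi> h"
    and root\<psi>: "\<And>g. g \<in> A \<Longrightarrow> \<psi> g \<in> fourth_roots" and \<psi>u: "\<psi> u = - 1"
  shows "card {p. p < n \<and> restrict (\<chi> p) A = restrict \<psi> A} = r"
proof -
  have one: "\<one> \<in> A" using A by (rule subgroup.one_closed)
  have "\<psi> \<one> * \<psi> \<one> = \<psi> \<one>" using mult\<psi>[OF one one] by simp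
  then have \<psi>1: "\<psi> \<one> = 1" using fourth_root_facts(2)[OF root\<psi>[OF one]] by simp
  let ?P = "\<lambda>p. restrict (\<chi> p) A = restrict \<psi> A"
  have inner: "(\<Sum>g\<in>A. \<chi> p g * cnj (\<psi> g)) = (if ?P p then of_nat (card A) else 0)" if p: "p < n" for p
  proof (cases "?P p")
    case True
    have "\<chi> p g = \<psi> g" if "g \<in> A" for g using fun_cong[OF True, of g] that by simp
    then show ?thesis using True by (simp add: fourth_root_facts(1)[OF root\<psi>])
  next
    case False
    then obtain h where h: "h \<in> A" "\<chi> p h \<noteq> \<psi> h" by (meson restrict_ext)
    \<comment> \<open>As \<open>\<psi> h\<close> has modulus 1, its conjugate is its inverse, so the
      quotient of the two characters is nontrivial at h.\<close>
    have "\<chi> p h * cnj (\<psi> h) \<noteq> 1"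
    proof
      assume "\<chi> p h * cnj (\<psi> h) = 1"
      then have "\<chi> p h * (\<psi> h * cnj (\<psi> h)) = \<psi> h" by (simp add: algebra_simps)
      then show False using h fourth_root_facts(1)[OF root\<psi>[OF h(1)]] by simp
    qed
    then have "(\<Sum>g\<in>A. \<chi> p g * cnj (\<psi> g)) = 0"
      using h(1) by (intro sum_nontrivial_character[OF A]) (simp_all add: mult[OF p] mult\<psi>)
    then show ?thesis using False by simp
  qed
  have "of_nat (card {p. p < n \<and> ?P p} * card A) = (\<Sum>p<n. if ?P p then of_nat (card A) else 0 :: complex)"
  proof -
    have "{..<n} \<inter> {p. ?P p} = {p. p < n \<and> ?P p}" by auto
    then show ?thesis by (simp add: sum.If_cases)
  qed
  also have "\<dots> = (\<Sum>p<n. \<Sum>g\<in>A. \<chi> p g * cnj (\<psi> g))" by (simp add: inner)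
  also have "\<dots> = (\<Sum>g\<in>A. (\<Sum>p<n. \<chi> p g) * cnj (\<psi> g))"
    by (subst sum.swap) (simp add: sum_distrib_right)
  also have "\<dots> = (\<Sum>g\<in>{\<one>, u}. (\<Sum>p<n. \<chi> p g) * cnj (\<psi> g))"
    by (rule sum.mono_neutral_right) (use finite_A one u sum_chars in auto)
  \<comment> \<open>Both surviving terms equal n: they are n * 1 at \<one> and (-n) * (-1) at
    \<open>u\<close>.\<close>
  also have "\<dots> = of_nat (2 * n)"
    using u one by (auto simp: sum_chars \<psi>1 \<psi>u)
  finally have "card {p. p < n \<and> ?P p} * card A = 2 * n" by (simp only: of_nat_eq_iff)
  then have "card {p. p < n \<and> ?P p} * card A = r * card A" by (simp add: card_A)
  then show ?thesis using card_A_pos by simp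
qed

lemma charsD:
  assumes "\<psi> \<in> chars"
  shows "\<And>g h. g \<in> A \<Longrightarrow> h \<in> A \<Longrightarrow> \<psi> (g \<otimes> h) = \<psi> g * \<psi> h"
    "\<And>g. g \<in> A \<Longrightarrow> \<psi> g \<in> fourth_roots" "\<psi> u = - 1" "restrict \<psi> A = \<psi>"
  using assms u A by (auto simp: chars_def root mult chi_at_u subgroup.m_closed)

lemma card_fibre:
  assumes "\<psi> \<in> chars"
  shows "card {p. p < n \<and> restrict (\<chi> p) A = \<psi>} = r"
  using multiplicity[of \<psi>] charsD[OF assms] by simp

text \<open>The conjugate is again a character with value -1 at \<open>u\<close>, and
  \<open>multiplicity\<close> covers every such character, including one not yet known to occur; the
  count r > 0 then shows that it does.\<close>

lemma conj_char_in_chars: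
  assumes "\<psi> \<in> chars"
  shows "conj_char \<psi> \<in> chars"
proof -
  have "card {p. p < n \<and> restrict (\<chi> p) A = restrict (conj_char \<psi>) A} = r"
    using charsD[OF assms] u(1) A
    by (intro multiplicity) (auto simp: conj_char_def subgroup.m_closed intro: fourth_root_facts(3))
  then have "{p. p < n \<and> restrict (\<chi> p) A = restrict (conj_char \<psi>) A} \<noteq> {}"
    using r_pos by (metis card.empty less_irrefl)
  then obtain p where "p < n" "restrict (\<chi> p) A = restrict (conj_char \<psi>) A" by blast
  moreover have "restrict (conj_char \<psi>) A = conj_char \<psi>"
    by (simp add: conj_char_def)
  ultimately show ?thesis unfolding chars_def by (intro image_eqI[of _ _ p]) simp_all
qed

text \<open>A nonreal character takes the value \<i> or -\<i> somewhere, so conjugation moves it,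
  and the nonreal ones split into pairs.\<close>

lemma chars_enumeration:
  obtains xs ys where "distinct (xs @ concat (map (\<lambda>y. [conj_char y, y]) ys))"
    "set (xs @ concat (map (\<lambda>y. [conj_char y, y]) ys)) = chars"
    "set xs = {\<psi> \<in> chars. \<forall>g\<in>A. \<psi> g = 1 \<or> \<psi> g = - 1}"
proof -
  let ?R = "{\<psi> \<in> chars. \<forall>g\<in>A. \<psi> g = 1 \<or> \<psi> g = - 1}"
  have fin: "finite chars" by (simp add: chars_def)
  obtain xs where xs: "set xs = ?R" "distinct xs"
    using finite_distinct_list[of ?R] fin by auto
  have cc: "conj_char (conj_char \<psi>) = \<psi>" if "\<psi> \<in> chars" for \<psi>
  proof -
    have "conj_char (conj_char \<psi>) = restrict \<psi> A" by (auto simp: conj_char_def)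
    then show ?thesis by (simp only: charsD(4)[OF that])
  qed
  have "\<exists>ys. distinct (concat (map (\<lambda>y. [conj_char y, y]) ys)) \<and>
      set (concat (map (\<lambda>y. [conj_char y, y]) ys)) = chars - ?R"
  proof (rule involution_pairing)
    fix \<psi> assume \<psi>: "\<psi> \<in> chars - ?R"
    then obtain g where g: "g \<in> A" "\<psi> g \<noteq> 1" "\<psi> g \<noteq> - 1" by auto
    have "\<psi> g = \<i> \<or> \<psi> g = - \<i>" using charsD(2)[of \<psi> g] \<psi> g by (auto simp: fourth_roots_def)
    then have "conj_char \<psi> g \<noteq> \<psi> g" "conj_char \<psi> g \<noteq> 1" "conj_char \<psi> g \<noteq> - 1"
      using g by (auto simp: conj_char_def complex_eq_iff)
    then show "conj_char \<psi> \<noteq> \<psi>" "conj_char \<psi> \<in> chars - ?R"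
      using conj_char_in_chars[of \<psi>] \<psi> g(1) by auto
    show "conj_char (conj_char \<psi>) = \<psi>" using cc \<psi> by auto
  qed (simp add: fin)
  then obtain ys where "distinct (concat (map (\<lambda>y. [conj_char y, y]) ys))"
    "set (concat (map (\<lambda>y. [conj_char y, y]) ys)) = chars - ?R" by blast
  then show thesis using xs by (intro that[of xs ys]) auto
qed

definition word :: "'a \<Rightarrow> bit list" where
  "word g = map (\<lambda>p. root_bit (\<chi> p g)) [0..<n]"

text \<open>Each element gets a word \<open>short g\<close> with one bit per distinct character.
  Every character fills exactly r columns, so \<open>word g\<close> is r copies of
  \<open>short g\<close> up to reordering, and correlations scale by r.\<close>

theorem word_replication:
  assumes inj: "inj_on word A"
    and orth: "\<And>g h. g \<in> A \<Longrightarrow> h \<in> A \<Longrightarrow>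
      word g = word h \<or> word h = complement (word g) \<or> corr (word g) (word h) = 0"
  shows "\<exists>a b D. hadamard_Z2Z4_linear_code a b D \<and> is_replication r D (word ` A) \<and>
    ((\<exists>z\<in>A. z \<otimes> z = u) \<longrightarrow> a = 0)"
proof -
  obtain xs ys where dist: "distinct (xs @ concat (map (\<lambda>y. [conj_char y, y]) ys))"
    and set_qs: "set (xs @ concat (map (\<lambda>y. [conj_char y, y]) ys)) = chars"
    and xs: "set xs = {\<psi> \<in> chars. \<forall>g\<in>A. \<psi> g = 1 \<or> \<psi> g = - 1}"
    by (rule chars_enumeration)
  define qs where "qs = xs @ concat (map (\<lambda>y. [conj_char y, y]) ys)"
  have qs: "distinct qs" "set qs = chars" using dist set_qs by (simp_all only: qs_def)
  define a b N where "a = length xs" and "b = length ys" and "N = length qs"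
  have N: "N = a + 2 * b"
    by (simp add: N_def qs_def a_def b_def length_concat comp_def sum_list_triv)
  have ys: "y \<in> chars" if "y \<in> set ys" for y using that set_qs by auto
  have xsi: "xs ! i \<in> chars" "\<And>g. g \<in> A \<Longrightarrow> (xs ! i) g = 1 \<or> (xs ! i) g = - 1" if "i < a" for i
    using that xs nth_mem[of i xs] by (auto simp: a_def)
  have ysj: "ys ! j \<in> chars" if "j < b" for j using that ys by (simp add: b_def)
  have mclosed: "g \<otimes> h \<in> A" if "g \<in> A" "h \<in> A" for g h
    using A that by (rule subgroup.m_closed)
  \<comment> \<open>Exponents of the kept characters: to base -1 for the real ones, to base \<i> for
    one member of each conjugate pair.\<close>
  define d where "d g = (\<lambda>i\<in>{..<a}. root_log2 ((xs ! i) g), \<lambda>j\<in>{..<b}. root_log4 ((ys ! j) g))" for g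
  define D where "D = d ` A"
  have hom: "d \<in> hom (G\<lparr>carrier := A\<rparr>) (Z2Z4_group a b)"
  proof (rule homI)
    fix g assume "g \<in> carrier (G\<lparr>carrier := A\<rparr>)"
    then show "d g \<in> carrier (Z2Z4_group a b)"
      using xsi ysj
      by (auto simp: d_def Z2Z4_group_def intro!: root_log2_facts(2) fourth_root_facts(6) charsD(2))
  next
    fix g h assume "g \<in> carrier (G\<lparr>carrier := A\<rparr>)" "h \<in> carrier (G\<lparr>carrier := A\<rparr>)"
    then have gh: "g \<in> A" "h \<in> A" by simp_all
    have "root_log2 ((xs ! i) (g \<otimes> h)) =
        root_log2 ((xs ! i) g) \<otimes>\<^bsub>integer_mod_group 2\<^esub> root_log2 ((xs ! i) h)" if "i < a" for i
      using xsi[OF that] gh by (simp only: charsD(1)) (simp only: root_log2_mult)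
    moreover have "root_log4 ((ys ! j) (g \<otimes> h)) =
        root_log4 ((ys ! j) g) \<otimes>\<^bsub>integer_mod_group 4\<^esub> root_log4 ((ys ! j) h)" if "j < b" for j
      using charsD(1,2)[OF ysj[OF that]] gh by (simp only: root_log4_mult)
    ultimately show "d (g \<otimes>\<^bsub>G\<lparr>carrier := A\<rparr>\<^esub> h) = d g \<otimes>\<^bsub>Z2Z4_group a b\<^esub> d h"
      by (auto simp: d_def Z2Z4_group_def fun_eq_iff simp del: mult_integer_mod_group)
  qed
  have D: "subgroup D (Z2Z4_group a b)"
  proof -
    have "group_hom (G\<lparr>carrier := A\<rparr>) (Z2Z4_group a b) d"
      unfolding group_hom_def group_hom_axioms_def
      using hom group_Z2Z4 subgroup.subgroup_is_group[OF A group_axioms] by blast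
    from group_hom.img_is_subgroup[OF this] show ?thesis by (simp add: D_def)
  qed
  define short where "short g = map (\<lambda>\<psi>. root_bit (\<psi> g)) qs" for g
  have gray_d: "gray_Z2Z4 a b (d g) = short g" if g: "g \<in> A" for g
  proof -
    have "map (\<lambda>i. gray_Z2 (fst (d g) i)) [0..<a] = map (\<lambda>\<psi>. [root_bit (\<psi> g)]) xs"
      by (rule nth_equalityI) (use xsi g in \<open>auto simp: d_def a_def intro!: root_log2_facts(1)\<close>)
    moreover have "map (\<lambda>i. gray_Z4 (snd (d g) i)) [0..<b] =
        map (\<lambda>\<psi>. [root_bit (conj_char \<psi> g), root_bit (\<psi> g)]) ys"
      by (rule nth_equalityI)
        (use ysj g charsD(2) in \<open>auto simp: d_def b_def conj_char_def intro!: fourth_root_facts(5)\<close>)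
    moreover have "gray_Z2Z4 a b (d g) = concat (map (\<lambda>i. gray_Z2 (fst (d g) i)) [0..<a]) @
        concat (map (\<lambda>i. gray_Z4 (snd (d g) i)) [0..<b])"
      by (simp add: gray_Z2Z4_def case_prod_beta)
    ultimately show ?thesis
      by (simp only:) (simp add: short_def qs_def map_concat comp_def)
  qed
  define K where "K = short ` A"
  have K: "K = gray_Z2Z4 a b ` D" using gray_d by (simp add: K_def D_def image_image)
  have fibre: "card {p. p < n \<and> restrict (\<chi> p) A = q} = r" if "q \<in> set qs" for q
    using that card_fibre qs(2) by simp
  have col: "restrict (\<chi> p) A \<in> set qs" if "p < n" for p
    using that qs(2) by (auto simp: chars_def)
  note sum_fibres = sum_uniform_fibres[OF qs(1) col fibre]
  obtain \<pi> where \<pi>: "\<pi> permutes {..<n}" "\<And>p. p < n \<Longrightarrow> qs ! (\<pi> p mod length qs) = restrict (\<chi> p) A"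
    using uniform_fibres_permutation[OF qs(1) col fibre] by blast
  have n: "n = r * N"
    using sum_fibres[where F = "\<lambda>_. 1::nat"] by (simp add: N_def)
  have N_pos: "0 < N" using n n_pos by (cases N) auto
  have cardA: "card A = 2 * N" using card_A n r_pos by simp
  have len_short: "length (short g) = N" for g by (simp add: short_def N_def)
  have word: "word g = permute_list \<pi> (concat (replicate r (short g)))" if g: "g \<in> A" for g
  proof (rule nth_equalityI)
    show "length (word g) = length (permute_list \<pi> (concat (replicate r (short g))))"
      by (simp add: word_def length_concat_replicate len_short flip: n)
    fix p assume "p < length (word g)"
    then have p: "p < n" by (simp add: word_def)
    have \<pi>p: "\<pi> p < r * N" using permutes_in_image[OF \<pi>(1)] p n by auto
    have "permute_list \<pi> (concat (replicate r (short g))) ! p = concat (replicate r (short g)) ! \<pi> p"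
      by (rule permute_list_nth) (use \<pi>(1) p n in \<open>simp_all add: length_concat_replicate len_short\<close>)
    also have "\<dots> = short g ! (\<pi> p mod N)"
      using nth_concat_replicate[of "\<pi> p" r "short g"] \<pi>p by (simp add: len_short)
    also have "\<dots> = root_bit ((qs ! (\<pi> p mod N)) g)"
      using N_pos by (simp add: short_def N_def)
    also have "\<dots> = word g ! p" using \<pi>(2)[OF p] p g by (simp add: word_def N_def)
    finally show "word g ! p = permute_list \<pi> (concat (replicate r (short g))) ! p" ..
  qed
  have rep: "is_replication r K (word ` A)"
    unfolding is_replication_def
    by (rule exI[of _ N], rule exI[of _ \<pi>]) (use \<pi>(1) n word in \<open>auto simp: K_def len_short image_image\<close>)
  have inj_short: "inj_on short A"
    by (rule inj_onI) (metis inj inj_onD word)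
  have corr_short: "corr (word g) (word h) = int r * corr (short g) (short h)"
    if "g \<in> A" "h \<in> A" for g h
  proof -
    have "corr (word g) (word h) =
        (\<Sum>p<n. (\<lambda>\<psi>. sgn_bit (root_bit (\<psi> g)) * sgn_bit (root_bit (\<psi> h))) (restrict (\<chi> p) A))"
      using that by (simp add: corr_def word_def)
    also have "\<dots> = int r * (\<Sum>i<length qs. sgn_bit (root_bit ((qs ! i) g)) * sgn_bit (root_bit ((qs ! i) h)))"
      by (rule sum_fibres)
    also have "\<dots> = int r * corr (short g) (short h)"
      by (simp add: corr_def short_def)
    finally show ?thesis .
  qed
  have one: "\<one> \<in> A" using A by (rule subgroup.one_closed)
  have "hadamard_code N K"
  proof (rule hadamard_codeI)
    show "0 < N" by fact
    show "card K = 2 * N" by (simp add: K_def card_image[OF inj_short] cardA)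
    show "length v = N" if "v \<in> K" for v using that len_short by (auto simp: K_def)
    have "root_bit (\<psi> \<one>) = 0" if "\<psi> \<in> chars" for \<psi>
    proof -
      have "\<psi> \<one> = 1"
        using charsD(1)[OF that one one] fourth_root_facts(2)[OF charsD(2)[OF that one]] by simp
      then show ?thesis by (simp add: root_bit_def complex_eq_iff)
    qed
    then have "short \<one> = replicate N 0"
      unfolding short_def N_def map_replicate_const[symmetric] map_eq_conv qs(2) by blast
    then show "replicate N 0 \<in> K" using one by (force simp: K_def)
    \<comment> \<open>Multiplication by \<open>u\<close> flips every bit, since all kept characters
      are -1 there.\<close>
    have "complement (short g) = short (g \<otimes> u)" if "g \<in> A" for g
    proof -
      have "root_bit (\<psi> (g \<otimes> u)) = 1 + root_bit (\<psi> g)" if "\<psi> \<in> chars" for \<psi>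
        using charsD(1)[OF that \<open>g \<in> A\<close> u(1)] charsD(3)[OF that]
          fourth_root_facts(4)[OF charsD(2)[OF that \<open>g \<in> A\<close>]] by simp
      then show ?thesis using qs(2) by (simp add: short_def complement_def)
    qed
    then show "complement v \<in> K" if "v \<in> K" for v
      using that u(1) mclosed by (auto simp: K_def)
    show "v = w \<or> w = complement v \<or> corr v w = 0" if v: "v \<in> K" and w: "w \<in> K" for v w
    proof -
      obtain g h where gh: "g \<in> A" "h \<in> A" "v = short g" "w = short h" using v w by (auto simp: K_def)
      consider "word g = word h" | "word h = complement (word g)" | "corr (word g) (word h) = 0"
        using orth[OF gh(1,2)] by blast
      then show ?thesis
      proof cases
        case 1
        then show ?thesis using inj gh by (auto dest: inj_onD)
      next
        case 2
        \<comment> \<open>Each kept character occupies some column p of the long word, where the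
          flip can be read off.\<close>
        have "root_bit (\<psi> h) = 1 + root_bit (\<psi> g)" if "\<psi> \<in> chars" for \<psi>
        proof -
          obtain p where p: "p < n" "\<psi> = restrict (\<chi> p) A" using \<open>\<psi> \<in> chars\<close> by (auto simp: chars_def)
          have "word h ! p = complement (word g) ! p" using 2 by simp
          then show ?thesis using p gh by (simp add: word_def complement_def del: add_bit_eq_xor)
        qed
        then show ?thesis using qs(2) gh by (simp add: short_def complement_def)
      next
        case 3
        then show ?thesis using corr_short[OF gh(1,2)] gh r_pos by simp
      qed
    qed
  qed
  moreover have "a = 0" if "z \<in> A" "z \<otimes> z = u" for z
  proof (rule ccontr)
    assume "a \<noteq> 0"
    then have 0: "0 < a" by simp
    \<comment> \<open>The square of a real character at z would be its value -1 at \<open>u\<close>,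
      impossible for 1 or -1.\<close>
    have "(xs ! 0) z * (xs ! 0) z = - 1"
      using charsD(1)[OF xsi(1)[OF 0] that(1) that(1)] charsD(3)[OF xsi(1)[OF 0]] that(2) by simp
    then show False using xsi(2)[OF 0 that(1)] by auto
  qed
  ultimately show ?thesis
    using rep D K N unfolding hadamard_Z2Z4_linear_code_def
    by (intro exI[of _ a] exI[of _ b] exI[of _ K]) auto
qed

end

section \<open>Standard abelian subgroups\<close>

lemma (in group) generate_centralizes:
  assumes S: "S \<subseteq> carrier G" and g: "g \<in> carrier G"
    and comm: "\<And>s. s \<in> S \<Longrightarrow> g \<otimes> s = s \<otimes> g" and h: "h \<in> generate G S"
  shows "g \<otimes> h = h \<otimes> g"
  using h
proof induction
  case (inv h)
  then have h: "h \<in> carrier G" using S by auto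
  have "g \<otimes> inv h = inv h \<otimes> (h \<otimes> g) \<otimes> inv h" using g h by (simp flip: m_assoc)
  also have "\<dots> = inv h \<otimes> (g \<otimes> h) \<otimes> inv h" using comm[OF inv] by simp
  also have "\<dots> = inv h \<otimes> g" using g h by (simp add: m_assoc)
  finally show ?case .
next
  case (eng h1 h2)
  have c: "h1 \<in> carrier G" "h2 \<in> carrier G" using eng.hyps S generate_in_carrier by auto
  have "g \<otimes> (h1 \<otimes> h2) = (g \<otimes> h1) \<otimes> h2" using g c by (simp add: m_assoc)
  also have "\<dots> = h1 \<otimes> (g \<otimes> h2)" using g c by (simp add: eng.IH(1) m_assoc)
  also have "\<dots> = (h1 \<otimes> h2) \<otimes> g" using g c by (simp add: eng.IH(2) m_assoc)
  finally show ?case .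
qed (use g comm in auto)

lemma (in group) generate_commutative:
  assumes S: "S \<subseteq> carrier G" and comm: "\<And>s t. s \<in> S \<Longrightarrow> t \<in> S \<Longrightarrow> s \<otimes> t = t \<otimes> s"
    and g: "g \<in> generate G S" and h: "h \<in> generate G S"
  shows "g \<otimes> h = h \<otimes> g"
proof (rule generate_centralizes[OF S _ _ h])
  show gc: "g \<in> carrier G" using g S generate_in_carrier by blast
  show "g \<otimes> s = s \<otimes> g" if s: "s \<in> S" for s
    using generate_centralizes[OF S _ comm[OF s] g] s S by auto
qed

lemma (in group) commutator_eq_iff:
  assumes "g \<in> carrier G" "h \<in> carrier G" "t \<in> carrier G"
  shows "commutator G g h = t \<longleftrightarrow> g \<otimes> h = t \<otimes> h \<otimes> g"
proof
  assume "commutator G g h = t"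
  then have "t \<otimes> h \<otimes> g = g \<otimes> h \<otimes> inv g \<otimes> inv h \<otimes> h \<otimes> g" by (simp add: commutator_def)
  also have "\<dots> = g \<otimes> h" using assms by (simp add: m_assoc)
  finally show "g \<otimes> h = t \<otimes> h \<otimes> g" ..
next
  assume "g \<otimes> h = t \<otimes> h \<otimes> g"
  then have "commutator G g h = t \<otimes> h \<otimes> g \<otimes> inv g \<otimes> inv h" by (simp add: commutator_def)
  also have "\<dots> = t" using assms by (simp add: m_assoc)
  finally show "commutator G g h = t" .
qed

lemma (in group) commutator_one_iff:
  assumes "g \<in> carrier G" "h \<in> carrier G"
  shows "commutator G g h = \<one> \<longleftrightarrow> g \<otimes> h = h \<otimes> g"
  using commutator_eq_iff[OF assms one_closed] assms by simp

text \<open>Moving g past h and past k costs a factor t each time; t slides past h and the two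
  factors cancel. This serves the product z 3 z 4 of shape 5.\<close>

lemma (in group) swap_twice_right:
  assumes c: "g \<in> carrier G" "h \<in> carrier G" "k \<in> carrier G" "t \<in> carrier G"
    and t: "t \<otimes> t = \<one>" "h \<otimes> t = t \<otimes> h"
    and gh: "g \<otimes> h = t \<otimes> h \<otimes> g" and gk: "g \<otimes> k = t \<otimes> k \<otimes> g"
  shows "g \<otimes> (h \<otimes> k) = (h \<otimes> k) \<otimes> g"
proof -
  have "g \<otimes> (h \<otimes> k) = (g \<otimes> h) \<otimes> k" using c by (simp add: m_assoc)
  also have "\<dots> = t \<otimes> h \<otimes> (g \<otimes> k)" unfolding gh using c by (simp add: m_assoc)
  also have "\<dots> = t \<otimes> (h \<otimes> t) \<otimes> k \<otimes> g" unfolding gk using c by (simp add: m_assoc)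
  also have "\<dots> = (t \<otimes> t) \<otimes> h \<otimes> k \<otimes> g" unfolding t(2) using c by (simp add: m_assoc)
  finally show ?thesis unfolding t(1) using c by simp
qed

text \<open>The mirror image, in which g and h each cost t when moved past k; it serves the product
  z 1 z 2 of shape 2.\<close>

lemma (in group) swap_twice_left:
  assumes c: "g \<in> carrier G" "h \<in> carrier G" "k \<in> carrier G" "t \<in> carrier G"
    and t: "t \<otimes> t = \<one>" "g \<otimes> t = t \<otimes> g"
    and gk: "g \<otimes> k = t \<otimes> k \<otimes> g" and hk: "h \<otimes> k = t \<otimes> k \<otimes> h"
  shows "(g \<otimes> h) \<otimes> k = k \<otimes> (g \<otimes> h)"
proof -
  have "(g \<otimes> h) \<otimes> k = g \<otimes> (h \<otimes> k)" using c by (simp add: m_assoc)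
  also have "\<dots> = (g \<otimes> t) \<otimes> k \<otimes> h" unfolding hk using c by (simp add: m_assoc)
  also have "\<dots> = t \<otimes> (g \<otimes> k) \<otimes> h" unfolding t(2) using c by (simp add: m_assoc)
  also have "\<dots> = (t \<otimes> t) \<otimes> k \<otimes> g \<otimes> h" unfolding gk using c by (simp add: m_assoc)
  finally show ?thesis unfolding t(1) using c by (simp add: m_assoc)
qed

lemma (in group) generate_singleton_involution:
  assumes "t \<in> carrier G" "t \<otimes> t = \<one>" "h \<in> generate G {t}"
  shows "h = \<one> \<or> h = t"
  using assms(3)
proof induction
  case (inv h)
  then show ?case using assms inv_equality[of t t] by auto
qed (use assms in auto)

text \<open>The union of A and A w is closed under products and inverses because conjugation by w
  preserves \<open>A\<close> and w^2 lies in \<open>A\<close>.\<close>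

lemma (in group) index_at_most_two:
  assumes A: "subgroup A G" and w: "w \<in> carrier G" and S: "S \<subseteq> carrier G"
    and square: "w \<otimes> w \<in> A"
    and normal: "\<And>a. a \<in> A \<Longrightarrow> w \<otimes> a \<otimes> inv w \<in> A"
    and gens: "\<And>s. s \<in> S \<Longrightarrow> s \<in> A \<or> s \<in> (\<lambda>a. a \<otimes> w) ` A"
  shows "generate G S \<subseteq> A \<union> (\<lambda>a. a \<otimes> w) ` A"
proof
  let ?B = "A \<union> (\<lambda>a. a \<otimes> w) ` A"
  have car: "a \<in> carrier G" if "a \<in> A" for a using A that by (rule subgroup.mem_carrier)
  note m = subgroup.m_closed[OF A] and i = subgroup.m_inv_closed[OF A]
  have coset: "a \<otimes> w \<in> ?B" if "a \<in> A" for a using that by blast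
  have move: "w \<otimes> a = (w \<otimes> a \<otimes> inv w) \<otimes> w" if "a \<in> A" for a
    using car[OF that] w by (simp add: m_assoc)
  have mult: "g \<otimes> h \<in> ?B" if g: "g \<in> ?B" and h: "h \<in> ?B" for g h
  proof -
    have 1: "a \<otimes> (b \<otimes> w) \<in> ?B" if "a \<in> A" "b \<in> A" for a b
      using coset[OF m[OF that]] car that w by (simp add: m_assoc)
    have 2: "(a \<otimes> w) \<otimes> b \<in> ?B" if "a \<in> A" "b \<in> A" for a b
    proof -
      have "(a \<otimes> w) \<otimes> b = a \<otimes> ((w \<otimes> b \<otimes> inv w) \<otimes> w)"
        using car that w by (simp add: m_assoc flip: move[OF that(2)])
      then show ?thesis using 1[OF that(1) normal[OF that(2)]] by simp
    qed
    have 3: "(a \<otimes> w) \<otimes> (b \<otimes> w) \<in> ?B" if "a \<in> A" "b \<in> A" for a b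
    proof -
      \<comment> \<open>The product is regrouped as a (w b w^-1) w^2, with all three factors in
        A.\<close>
      have "inv w \<otimes> (w \<otimes> w) = w" using w by (simp flip: m_assoc)
      then have "(a \<otimes> w) \<otimes> (b \<otimes> w) = a \<otimes> (w \<otimes> b \<otimes> inv w) \<otimes> (w \<otimes> w)"
        using car that w by (simp add: m_assoc)
      then show ?thesis using m[OF m[OF that(1) normal[OF that(2)]] square] by simp
    qed
    from g h show ?thesis
      by (elim UnE imageE) (simp_all only: UnI1 m 1 2 3)
  qed
  have inverse: "inv s \<in> ?B" if s: "s \<in> ?B" for s
  proof (cases "s \<in> A")
    case False
    then obtain a where a: "a \<in> A" "s = a \<otimes> w" using s by blast
    \<comment> \<open>The factor w^-1 is written as (w^2)^-1 w, so that no negative power of w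
      remains outside A.\<close>
    have "inv s = inv (w \<otimes> w) \<otimes> (w \<otimes> inv a)"
      using a car w by (simp add: inv_mult_group m_assoc flip: m_assoc[of "inv w" w])
    also have "\<dots> = inv (w \<otimes> w) \<otimes> ((w \<otimes> inv a \<otimes> inv w) \<otimes> w)"
      by (simp only: flip: move[OF i[OF a(1)]])
    finally show ?thesis
      using coset[OF normal[OF i[OF a(1)]]] i[OF square] mult by simp
  qed (use i in blast)
  fix h assume "h \<in> generate G S"
  then show "h \<in> ?B"
  proof induction
    case one
    then show ?case using subgroup.one_closed[OF A] by blast
  next
    case (inv h)
    then show ?case using inverse gens by blast
  qed (use gens mult in blast)+
qed

lemma gray_one: "gray k1 k2 k3 \<one>\<^bsub>Z2Z4Q8_group k1 k2 k3\<^esub> = replicate (k1 + 2 * k2 + 4 * k3) 0"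
  using gray_eq_chi[OF monoid.one_closed[OF group.is_monoid[OF group_Z2Z4Q8]]]
  by (simp add: chi_one root_bit_def complex_eq_iff)

lemma gray_u: "gray k1 k2 k3 (u_elem k1 k2 k3) = replicate (k1 + 2 * k2 + 4 * k3) 1"
  by (simp add: gray_eq_chi[OF u_elem_closed] chi_u root_bit_def)

section \<open>Squares, involutions and commutators of the ambient group\<close>

context
  fixes k1 k2 k3 :: nat and G :: "Z2Z4Q8_elem monoid" (structure) and u :: Z2Z4Q8_elem
  defines "G \<equiv> Z2Z4Q8_group k1 k2 k3" and "u \<equiv> u_elem k1 k2 k3"
begin

interpretation group G unfolding G_def by (rule group_Z2Z4Q8)

lemma square_eq: "g \<in> carrier G \<Longrightarrow> g [^] (2::nat) = g \<otimes> g"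
  by (simp add: numeral_2_eq_2)

text \<open>Every coordinate group has exponent dividing 4.\<close>

lemma Z2Z4Q8_square_square:
  assumes "g \<in> carrier G"
  shows "(g \<otimes> g) \<otimes> (g \<otimes> g) = \<one>"
proof -
  obtain x y w where g: "g = ((x, y), w)" by (metis surj_pair)
  have w: "w i \<in> carrier Q8" if "i < k3" for i
    using assms that unfolding g G_def carrier_Z2Z4Q8 by auto
  have "(x + x) mod 2 = 0" "((x + x) mod 4 + (x + x) mod 4) mod 4 = 0" for x :: int by presburger+
  then show ?thesis
    unfolding g G_def mult_Z2Z4Q8 one_Z2Z4Q8
    by (auto simp: fun_eq_iff Q8_square_square[OF w])
qed

lemma Z2Z4Q8_involution_central:
  assumes "g \<in> carrier G" "h \<in> carrier G" "g \<otimes> g = \<one>"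
  shows "g \<otimes> h = h \<otimes> g"
proof -
  obtain x y w where g: "g = ((x, y), w)" by (metis surj_pair)
  obtain x' y' w' where h: "h = ((x', y'), w')" by (metis surj_pair)
  have w: "w i \<in> carrier Q8" "w' i \<in> carrier Q8" if "i < k3" for i
    using assms(1,2) that unfolding g h G_def carrier_Z2Z4Q8 by auto
  have sq: "(\<lambda>i\<in>{..<k3}. w i \<otimes>\<^bsub>Q8\<^esub> w i) = (\<lambda>i\<in>{..<k3}. (0, 0))"
    using assms(3) unfolding g G_def mult_Z2Z4Q8 one_Z2Z4Q8 by simp
  have "w i \<otimes>\<^bsub>Q8\<^esub> w i = (0, 0)" if "i < k3" for i
    using fun_cong[OF sq, of i] that by simp
  then have "w i \<otimes>\<^bsub>Q8\<^esub> w' i = w' i \<otimes>\<^bsub>Q8\<^esub> w i" if "i < k3" for i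
    using Q8_involution_central[OF w[OF that]] that by blast
  then show ?thesis
    unfolding g h G_def mult_Z2Z4Q8 by (auto simp: fun_eq_iff add.commute)
qed

text \<open>The factor t is the commutator of g and h: trivial on the abelian coordinates, and 1 or
  a^2 on each Q8-coordinate.\<close>

lemma Z2Z4Q8_swap:
  assumes "g \<in> carrier G" "h \<in> carrier G"
  shows "\<exists>t\<in>carrier G. t \<otimes> t = \<one> \<and> g \<otimes> h = t \<otimes> (h \<otimes> g)"
proof -
  obtain x y w where g: "g = ((x, y), w)" by (metis surj_pair)
  obtain x' y' w' where h: "h = ((x', y'), w')" by (metis surj_pair)
  note gc = assms[unfolded g h G_def carrier_Z2Z4Q8]
  have w: "w i \<in> carrier Q8" "w' i \<in> carrier Q8" if "i < k3" for i
    using gc that by auto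
  define q where "q = (\<lambda>i\<in>{..<k3}. if w i \<otimes>\<^bsub>Q8\<^esub> w' i = w' i \<otimes>\<^bsub>Q8\<^esub> w i then (0, 0) else (2::int, 0::int))"
  define t :: Z2Z4Q8_elem where "t = ((\<lambda>i\<in>{..<k1}. 0, \<lambda>i\<in>{..<k2}. 0), q)"
  have "t \<in> carrier G"
    unfolding t_def G_def carrier_Z2Z4Q8 by (auto simp: q_def carrier_Q8)
  moreover have "q i \<otimes>\<^bsub>Q8\<^esub> q i = (0, 0)" if "i < k3" for i
    using that by (simp add: q_def Q8_def)
  then have "t \<otimes> t = \<one>"
    unfolding t_def G_def mult_Z2Z4Q8 one_Z2Z4Q8 by (auto simp: fun_eq_iff)
  moreover have "w i \<otimes>\<^bsub>Q8\<^esub> w' i = q i \<otimes>\<^bsub>Q8\<^esub> (w' i \<otimes>\<^bsub>Q8\<^esub> w i)" if "i < k3" for i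
  proof -
    have "w' i \<otimes>\<^bsub>Q8\<^esub> w i \<in> carrier Q8"
      using w[OF that] group_Q8 by (simp add: group.is_monoid monoid.m_closed)
    then have "(0, 0) \<otimes>\<^bsub>Q8\<^esub> (w' i \<otimes>\<^bsub>Q8\<^esub> w i) = w' i \<otimes>\<^bsub>Q8\<^esub> w i"
      using monoid.l_one[OF group.is_monoid[OF group_Q8]] by (simp add: Q8_def)
    then show ?thesis
      using Q8_swap_up_to_involution[OF w[OF that]] that by (auto simp: q_def)
  qed
  then have "g \<otimes> h = t \<otimes> (h \<otimes> g)"
    unfolding t_def g h G_def mult_Z2Z4Q8 by (auto simp: fun_eq_iff add.commute)
  ultimately show ?thesis by blast
qed

lemma u_elem_square:
  "u_elem k1 k2 k3 \<otimes> u_elem k1 k2 k3 = \<one>"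
  unfolding u_elem_def G_def mult_Z2Z4Q8 one_Z2Z4Q8 qa_square by (auto simp: fun_eq_iff Q8_def)

section \<open>Hadamard group codes and their abelian subgroups\<close>

lemma hadamard_code_length:
  assumes "subgroup C G" "hadamard_code n (gray k1 k2 k3 ` C)"
  shows "n = k1 + 2 * k2 + 4 * k3"
proof -
  have "\<one> \<in> C" using assms(1) by (rule subgroup.one_closed)
  then have "length (gray k1 k2 k3 \<one>) = n" using hadamard_codeD(3)[OF assms(2)] by blast
  then show ?thesis using length_gray[of \<one> k1 k2 k3] by (simp add: G_def[symmetric])
qed

text \<open>The all-ones word belongs to the code and is the Gray image of \<open>u\<close>;
  injectivity of the Gray map identifies its source.\<close>

lemma u_in_hadamard_code:
  assumes "subgroup C G" "hadamard_code n (gray k1 k2 k3 ` C)"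
  shows "u \<in> C"
proof -
  obtain c where c: "c \<in> C" "gray k1 k2 k3 c = gray k1 k2 k3 u"
    using hadamard_codeD(5)[OF assms(2)] hadamard_code_length[OF assms] gray_u[of k1 k2 k3]
    unfolding u_def by force
  have "c \<in> carrier G" using assms(1) c(1) by (rule subgroup.mem_carrier)
  then have "c = u"
    using inj_onD[OF inj_gray c(2)] u_elem_closed unfolding G_def u_def by blast
  then show ?thesis using c(1) by simp
qed

lemma card_hadamard_group:
  assumes "subgroup C G" "hadamard_code n (gray k1 k2 k3 ` C)"
  shows "card C = 2 * n"
proof -
  have "inj_on (gray k1 k2 k3) C"
    using inj_gray subgroup.subset[OF assms(1)] unfolding G_def by (rule inj_on_subset)
  then show ?thesis using hadamard_codeD(2)[OF assms(2)] card_image by metis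
qed

text \<open>The p-th entries of \<open>chi\<close> are the characters. Their sum at g is the
  correlation of the Gray word of g with the zero word, to which the Hadamard property of the whole
  code applies because \<open>A\<close> lies in \<open>C\<close>.\<close>

theorem abelian_subgroup_replication:
  assumes C: "subgroup C G" and had: "hadamard_code n (gray k1 k2 k3 ` C)"
    and sub: "subgroup A G" "A \<subseteq> C" and comm: "\<And>g h. g \<in> A \<Longrightarrow> h \<in> A \<Longrightarrow> g \<otimes> h = h \<otimes> g"
    and u: "u \<in> A" and r: "r * card A = 2 * n"
  shows "\<exists>a b D. hadamard_Z2Z4_linear_code a b D \<and> is_replication r D (gray k1 k2 k3 ` A) \<and>
    ((\<exists>z\<in>A. z \<otimes> z = u) \<longrightarrow> a = 0)"
proof -
  note n = hadamard_code_length[OF C had] and n_pos = hadamard_codeD(1)[OF had]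
    and orth = hadamard_codeD(6)[OF had]
  have car: "g \<in> carrier (Z2Z4Q8_group k1 k2 k3)" if "g \<in> A" for g
    using subgroup.mem_carrier[OF sub(1) that] by (simp add: G_def)
  have one: "\<one> \<in> A" using sub(1) by (rule subgroup.one_closed)
  have gray1: "gray k1 k2 k3 \<one> = replicate n 0" using gray_one[of k1 k2 k3] n by (simp add: G_def)
  have grayu: "gray k1 k2 k3 u = replicate n 1" using gray_u[of k1 k2 k3] n by (simp add: u_def)
  have len: "length (gray k1 k2 k3 g) = n" "length (chi k1 k2 k3 g) = n" if "g \<in> A" for g
    using length_gray[OF car[OF that]] length_chi[OF car[OF that]] n by simp_all
  have inj: "inj_on (gray k1 k2 k3) A" using inj_gray car by (blast intro: inj_on_subset)
  have corr0: "corr (gray k1 k2 k3 g) (gray k1 k2 k3 \<one>) =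
      (if g = \<one> then int n else if g = u then - int n else 0)" if g: "g \<in> A" for g
  proof -
    consider "g = \<one>" | "g = u" | "g \<noteq> \<one>" "g \<noteq> u" by blast
    then show ?thesis
    proof cases
      case 1
      then show ?thesis by (simp add: corr_self len one)
    next
      case 2
      have "gray k1 k2 k3 u = complement (gray k1 k2 k3 \<one>)"
        by (simp add: gray1 grayu complement_replicate)
      then have "corr (gray k1 k2 k3 g) (gray k1 k2 k3 \<one>) = - int n"
        using 2 by (simp add: corr_complement corr_self gray1)
      moreover have "g \<noteq> \<one>" using 2 gray1 grayu n_pos by auto
      ultimately show ?thesis using 2 by simp
    next
      case 3
      have "gray k1 k2 k3 g \<noteq> gray k1 k2 k3 \<one>" using 3(1) g one inj by (auto dest: inj_onD)
      moreover have "gray k1 k2 k3 \<one> \<noteq> complement (gray k1 k2 k3 g)"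
      proof
        assume "gray k1 k2 k3 \<one> = complement (gray k1 k2 k3 g)"
        then have "gray k1 k2 k3 g = complement (replicate n 0)"
          by (metis complement_complement gray1)
        then have "gray k1 k2 k3 g = gray k1 k2 k3 u" by (simp add: grayu complement_replicate)
        then show False using 3(2) g u inj by (auto dest: inj_onD)
      qed
      ultimately have "corr (gray k1 k2 k3 g) (gray k1 k2 k3 \<one>) = 0"
        using orth[of "gray k1 k2 k3 g" "gray k1 k2 k3 \<one>"] g one sub(2) by blast
      then show ?thesis using 3 by simp
    qed
  qed
  interpret hadamard_characters G A u n r "\<lambda>p g. chi k1 k2 k3 g ! p"
  proof (rule hadamard_characters.intro[OF group_axioms hadamard_characters_axioms.intro])
    show "subgroup A G" "u \<in> A" "r * card A = 2 * n" "0 < n" by fact+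
    show "finite A" using r n_pos by (cases "finite A") auto
    show "u \<noteq> \<one>" using gray1 grayu n_pos by auto
    show "chi k1 k2 k3 g ! p \<in> fourth_roots" if "p < n" "g \<in> A" for p g
      using set_chi len(2)[OF that(2)] that(1) by (metis nth_mem subsetD)
    fix p g h assume p: "p < n" and g: "g \<in> A" and h: "h \<in> A"
    show "chi k1 k2 k3 (g \<otimes> h) ! p = chi k1 k2 k3 g ! p * chi k1 k2 k3 h ! p"
      using chi_mult[OF car[OF g] car[OF h]] comm[OF g h] p by (simp add: G_def len g h)
  next
    fix p assume "p < n"
    then show "chi k1 k2 k3 u ! p = - 1" using n by (simp add: u_def chi_u)
  next
    fix g assume g: "g \<in> A"
    have "(\<Sum>p<n. chi k1 k2 k3 g ! p) = sum_list (chi k1 k2 k3 g)"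
      by (simp add: sum_list_sum_nth len(2)[OF g] lessThan_atLeast0)
    also have "\<dots> = of_int (sum_list (map sgn_bit (gray k1 k2 k3 g)))"
      by (rule sum_chi[OF car[OF g]])
    also have "sum_list (map sgn_bit (gray k1 k2 k3 g)) = corr (gray k1 k2 k3 g) (gray k1 k2 k3 \<one>)"
      by (simp add: sum_list_sum_nth corr_def len(1)[OF g] gray1 lessThan_atLeast0)
    finally show "(\<Sum>p<n. chi k1 k2 k3 g ! p) =
        (if g = \<one> then of_nat n else if g = u then - of_nat n else 0)"
      by (simp add: corr0[OF g])
  qed
  have word: "word g = gray k1 k2 k3 g" if "g \<in> A" for g
    unfolding word_def gray_eq_chi[OF car[OF that]]
    by (rule nth_equalityI) (simp_all add: len(2)[OF that])
  have "word ` A = gray k1 k2 k3 ` A" using word by simp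
  moreover have "inj_on word A" using inj word by (simp add: inj_on_def)
  moreover have "word g = word h \<or> word h = complement (word g) \<or> corr (word g) (word h) = 0"
    if "g \<in> A" "h \<in> A" for g h
    using orth[OF imageI[OF subsetD[OF sub(2) that(1)]] imageI[OF subsetD[OF sub(2) that(2)]]]
    by (simp add: word that)
  ultimately show ?thesis using word_replication by simp
qed

section \<open>Subgroups containing T(C)\<close>

lemma T_part_iff:
  assumes "subgroup C G"
  shows "t \<in> T_part G C \<longleftrightarrow> t \<in> C \<and> t \<otimes> t = \<one>"
  using subgroup.mem_carrier[OF assms, of t] by (auto simp: T_part_def square_eq)

text \<open>Elements of T(C) are central in the ambient group, so adjoining them to commuting
  generators keeps the subgroup abelian.\<close>

lemma torsion_extension:
  assumes C: "subgroup C G" and S: "S \<subseteq> C"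
    and comm: "\<And>s t. s \<in> S \<Longrightarrow> t \<in> S \<Longrightarrow> s \<otimes> t = t \<otimes> s"
    and A: "A = generate G (T_part G C \<union> S)"
  shows "subgroup A G" "A \<subseteq> C" "T_part G C \<subseteq> A" "S \<subseteq> A"
    "\<And>g h. g \<in> A \<Longrightarrow> h \<in> A \<Longrightarrow> g \<otimes> h = h \<otimes> g"
proof -
  have TS: "T_part G C \<union> S \<subseteq> C" using S by (auto simp: T_part_def)
  then have TSc: "T_part G C \<union> S \<subseteq> carrier G" using subgroup.subset[OF C] by blast
  show "subgroup A G" unfolding A by (rule generate_is_subgroup[OF TSc])
  show "A \<subseteq> C" unfolding A by (rule generate_subgroup_incl[OF TS C])
  show "T_part G C \<subseteq> A" "S \<subseteq> A" unfolding A by (auto intro: generate.incl)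
  have central: "s \<otimes> t = t \<otimes> s" if "s \<in> T_part G C" "t \<in> T_part G C \<union> S" for s t
    using that TSc T_part_iff[OF C, of s] by (intro Z2Z4Q8_involution_central) blast+
  have "s \<otimes> t = t \<otimes> s" if "s \<in> T_part G C \<union> S" "t \<in> T_part G C \<union> S" for s t
    using that central[of s t] central[of t s] comm[of s t] by auto
  then show "\<And>g h. g \<in> A \<Longrightarrow> h \<in> A \<Longrightarrow> g \<otimes> h = h \<otimes> g"
    unfolding A by (rule generate_commutative[OF TSc])
qed

text \<open>Squares and commutators of elements of \<open>C\<close> lie in T(C) and so in
  \<open>A\<close>. Conjugation by w therefore preserves \<open>A\<close>, and
  \<open>index_at_most_two\<close> applies.\<close>

lemma index_over_torsion:
  assumes C: "subgroup C G" "finite C" and A: "subgroup A G" "A \<subseteq> C" "T_part G C \<subseteq> A"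
    and w: "w \<in> C" and X: "C = generate G X" "X \<subseteq> C"
    and gens: "\<And>s. s \<in> X \<Longrightarrow> s \<in> A \<or> s \<in> (\<lambda>a. a \<otimes> w) ` A"
  shows "card C \<le> 2 * card A"
proof -
  have car: "c \<in> carrier G" if "c \<in> C" for c using C(1) that by (rule subgroup.mem_carrier)
  note m = subgroup.m_closed[OF C(1)] and i = subgroup.m_inv_closed[OF C(1)]
  have "generate G X \<subseteq> A \<union> (\<lambda>a. a \<otimes> w) ` A"
  proof (rule index_at_most_two[OF A(1) car[OF w] _ _ _ gens])
    show "X \<subseteq> carrier G" using X(2) car by blast
    show "w \<otimes> w \<in> A"
      using A(3) T_part_iff[OF C(1)] m[OF w w] Z2Z4Q8_square_square[of w] car[OF w]
      by blast
    fix a assume a: "a \<in> A"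
    then have aC: "a \<in> C" using A(2) by blast
    obtain t where t: "t \<in> carrier G" "t \<otimes> t = \<one>" "w \<otimes> a = t \<otimes> (a \<otimes> w)"
      using Z2Z4Q8_swap[of w a] car[OF w] car[OF aC] by blast
    have ta: "w \<otimes> a \<otimes> inv w = t \<otimes> a"
      using t(1,3) car[OF w] car[OF aC] by (simp add: m_assoc)
    \<comment> \<open>Thus t is the commutator of w and a, hence in \<open>C\<close>; as its square
      is trivial, it lies in T(C).\<close>
    then have "t = w \<otimes> a \<otimes> inv w \<otimes> inv a"
      using t(1) car[OF w] car[OF aC] by (simp add: m_assoc)
    then have "t \<in> C" using w aC by (simp add: m i)
    then have "t \<in> A" using A(3) T_part_iff[OF C(1)] t(2) by blast
    then show "w \<otimes> a \<otimes> inv w \<in> A" unfolding ta using a by (rule subgroup.m_closed[OF A(1)])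
  qed
  then have "C \<subseteq> A \<union> (\<lambda>a. a \<otimes> w) ` A" using X(1) by simp
  then have "card C \<le> card (A \<union> (\<lambda>a. a \<otimes> w) ` A)"
    using finite_subset[OF A(2) C(2)] by (intro card_mono) auto
  also have "\<dots> \<le> card A + card ((\<lambda>a. a \<otimes> w) ` A)" by (rule card_Un_le)
  also have "\<dots> \<le> 2 * card A" using card_image_le[OF finite_subset[OF A(2) C(2)]] by simp
  finally show ?thesis .
qed

text \<open>Outside shape 5 one coset representative w suffices: z 2 in shapes 2, 4 and 4s, and z 1
  in shape 3. In shape 5 the index is not bounded; the square root z 1 of \<open>u\<close> is
  recorded instead.\<close>

lemma standard_abelian_subgroup_properties:
  assumes C: "subgroup C G" and gen: "generated_normally G C \<sigma> \<delta> \<rho> x y z"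
    and shape: "has_shape G u C \<delta> \<rho> z s" "s \<noteq> Shape1" "s \<noteq> Shape1s"
    and A: "A = standard_abelian_subgroup G C \<rho> y z s"
  shows "subgroup A G \<and> A \<subseteq> C \<and> T_part G C \<subseteq> A \<and> (\<forall>g\<in>A. \<forall>h\<in>A. g \<otimes> h = h \<otimes> g) \<and>
    (if s = Shape5 then \<exists>g\<in>A. g \<otimes> g = u else finite C \<longrightarrow> card C \<le> 2 * card A)"
proof -
  let ?X = "x ` {1..\<sigma>} \<union> y ` {1..\<delta>} \<union> z ` {1..\<rho>}"
  have X: "C = generate G ?X" "?X \<subseteq> C" and T: "T_part G C = generate G (x ` {1..\<sigma>})"
    and center: "center_of G C = generate G (x ` {1..\<sigma>} \<union> y ` {1..\<delta>})"
    using gen unfolding generated_normally_def by blast+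
  have car: "c \<in> carrier G" if "c \<in> C" for c using C that by (rule subgroup.mem_carrier)
  have xT: "s \<in> T_part G C" if "s \<in> x ` {1..\<sigma>}" for s
    unfolding T using that by (rule generate.incl)
  have zC: "z i \<in> C" if "1 \<le> i" "i \<le> \<rho>" for i
    using X(2) that by auto
  have zc: "z i \<in> carrier G" if "1 \<le> i" "i \<le> \<rho>" for i
    using car[OF zC[OF that]] .
  have sqT: "c \<otimes> c \<in> T_part G C" if "c \<in> C" for c
    using T_part_iff[OF C] subgroup.m_closed[OF C that that] Z2Z4Q8_square_square[OF car[OF that]] by blast
  have sq_central: "g \<otimes> (c \<otimes> c) = (c \<otimes> c) \<otimes> g" if "c \<in> C" "g \<in> C" for c g
    using Z2Z4Q8_involution_central[of "c \<otimes> c" g] Z2Z4Q8_square_square[OF car[OF that(1)]]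
      car[OF that(1)] car[OF that(2)] by simp
  \<comment> \<open>The generators x lie in T(C), so only the y and z have to be located in A or A
    w.\<close>
  have result: ?thesis
    if S: "S \<subseteq> C" and comm: "\<And>s t. s \<in> S \<Longrightarrow> t \<in> S \<Longrightarrow> s \<otimes> t = t \<otimes> s"
      and AS: "A = generate G (T_part G C \<union> S)" and w: "w \<in> C" and s: "s \<noteq> Shape5"
      and gens: "\<And>g. S \<subseteq> A \<Longrightarrow> T_part G C \<subseteq> A \<Longrightarrow> subgroup A G \<Longrightarrow> g \<in> y ` {1..\<delta>} \<union> z ` {1..\<rho>} \<Longrightarrow>
        g \<in> A \<or> g \<in> (\<lambda>a. a \<otimes> w) ` A" for S w
  proof -
    note ext = torsion_extension[OF C S comm AS]
    have "g \<in> A \<or> g \<in> (\<lambda>a. a \<otimes> w) ` A" if "g \<in> ?X" for g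
      using that xT[of g] gens[OF ext(4,3,1), of g] ext(3) by blast
    then have "finite C \<longrightarrow> card C \<le> 2 * card A"
      using index_over_torsion[OF C _ ext(1-3) w X] by blast
    then show ?thesis using ext s by simp
  qed
  have in_coset: "w \<in> (\<lambda>a. a \<otimes> w) ` A" if "subgroup A G" "w \<in> C" for w
    using subgroup.one_closed[OF that(1)] car[OF that(2)] by (intro image_eqI[of _ _ \<one>]) auto
  show ?thesis
  proof (cases s)
    case Shape2
    then have \<delta>: "\<delta> = 0" and \<rho>: "2 \<le> \<rho>"
      and zz: "\<And>i j. i \<in> {1, 2} \<Longrightarrow> j \<in> {3..\<rho>} \<Longrightarrow> commutator G (z i) (z j) = z j [^] (2::nat)"
        "\<And>j k. j \<in> {3..\<rho>} \<Longrightarrow> k \<in> {3..\<rho>} \<Longrightarrow> commutator G (z j) (z k) = \<one>"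
      using shape(1) by auto
    let ?S = "{z 1 \<otimes> z 2} \<union> z ` {3..\<rho>}"
    have z12: "z 1 \<in> C" "z 2 \<in> C" using zC \<rho> by auto
    \<comment> \<open>Both z 1 and z 2 pick up (z j)^2 when moved past z j, and the two factors
      cancel in the product.\<close>
    have cz: "(z 1 \<otimes> z 2) \<otimes> z j = z j \<otimes> (z 1 \<otimes> z 2)" if j: "j \<in> {3..\<rho>}" for j
    proof -
      have zj: "z j \<in> C" using zC j by auto
      have "z i \<otimes> z j = (z j \<otimes> z j) \<otimes> z j \<otimes> z i" if "i \<in> {1, 2}" for i
      proof -
        have "z i \<in> carrier G" using that car[OF z12(1)] car[OF z12(2)] by auto
        then show ?thesis
          using zz(1)[OF that j] commutator_eq_iff[of "z i" "z j" "z j \<otimes> z j"] car[OF zj]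
          by (simp add: square_eq)
      qed
      then show ?thesis
        using z12 zj car Z2Z4Q8_square_square sq_central
        by (intro swap_twice_left[of _ _ _ "z j \<otimes> z j"]) auto
    qed
    have czz: "z j \<otimes> z k = z k \<otimes> z j" if "j \<in> {3..\<rho>}" "k \<in> {3..\<rho>}" for j k
      using zz(2)[OF that] commutator_one_iff[of "z j" "z k"] zc that by simp
    show ?thesis
    proof (rule result[of ?S "z 2"])
      show "?S \<subseteq> C" using z12 zC subgroup.m_closed[OF C] by auto
      show "s' \<otimes> t = t \<otimes> s'" if s't: "s' \<in> ?S" "t \<in> ?S" for s' t
        using s't by (elim UnE imageE singletonE) (simp_all only: cz czz)
      show "A = generate G (T_part G C \<union> ?S)" using A Shape2 by (simp add: Un_assoc)
      fix g assume SA: "?S \<subseteq> A" "T_part G C \<subseteq> A" "subgroup A G"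
        and "g \<in> y ` {1..\<delta>} \<union> z ` {1..\<rho>}"
      then obtain i where i: "i \<in> {1..\<rho>}" "g = z i" using \<delta> by auto
      then consider "i = 1" | "i = 2" | "i \<in> {3..\<rho>}" by fastforce
      then show "g \<in> A \<or> g \<in> (\<lambda>a. a \<otimes> z 2) ` A"
      proof cases
        case 1
        \<comment> \<open>The correction (z 2)^2 belongs to T(C), which places z 1 in the coset A (z
          2).\<close>
        have "z 1 = (z 1 \<otimes> z 2) \<otimes> inv (z 2 \<otimes> z 2) \<otimes> z 2"
          using car[OF z12(1)] car[OF z12(2)] by (simp add: inv_mult_group m_assoc)
        moreover have "(z 1 \<otimes> z 2) \<otimes> inv (z 2 \<otimes> z 2) \<in> A"
          by (rule subgroup.m_closed[OF SA(3) _ subgroup.m_inv_closed[OF SA(3)]])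
            (use SA sqT[OF z12(2)] in blast)+
        ultimately show ?thesis using 1 i by blast
      next
        case 2
        then show ?thesis using i in_coset[OF SA(3) z12(2)] by simp
      qed (use SA i in auto)
    qed (use z12 Shape2 in auto)
  next
    case Shape3
    then have \<delta>: "\<delta> = 0" and \<rho>: "1 \<le> \<rho>"
      and zz: "\<And>i j. i \<in> {2..\<rho>} \<Longrightarrow> j \<in> {2..\<rho>} \<Longrightarrow> i \<noteq> j \<Longrightarrow> commutator G (z i) (z j) = \<one>"
      using shape(1) by auto
    have z1: "z 1 \<in> C" using zC \<rho> by auto
    have czz: "z i \<otimes> z j = z j \<otimes> z i" if "i \<in> {2..\<rho>}" "j \<in> {2..\<rho>}" for i j
      using zz[OF that] commutator_one_iff[of "z i" "z j"] zc that by (cases "i = j") simp_all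
    show ?thesis
    proof (rule result[of "z ` {2..\<rho>}" "z 1"])
      show "z ` {2..\<rho>} \<subseteq> C" using zC by auto
      show "s' \<otimes> t = t \<otimes> s'" if "s' \<in> z ` {2..\<rho>}" "t \<in> z ` {2..\<rho>}" for s' t
        using that by (elim imageE) (simp only: czz)
      show "A = generate G (T_part G C \<union> z ` {2..\<rho>})" using A Shape3 by simp
      fix g assume SA: "z ` {2..\<rho>} \<subseteq> A" "T_part G C \<subseteq> A" "subgroup A G"
        and "g \<in> y ` {1..\<delta>} \<union> z ` {1..\<rho>}"
      then obtain i where i: "i \<in> {1..\<rho>}" "g = z i" using \<delta> by auto
      then consider "i = 1" | "i \<in> {2..\<rho>}" by fastforce
      then show "g \<in> A \<or> g \<in> (\<lambda>a. a \<otimes> z 1) ` A"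
        using SA(1) in_coset[OF SA(3) z1] i by cases auto
    qed (use z1 Shape3 in auto)
  next
    case Shape4
    then have \<delta>: "\<delta> = 0" and \<rho>: "\<rho> = 2" using shape(1) by auto
    have z12: "z 1 \<in> C" "z 2 \<in> C" using zC \<rho> by auto
    show ?thesis
    proof (rule result[of "{z 1}" "z 2"])
      show "A = generate G (T_part G C \<union> {z 1})" using A Shape4 by simp
      fix g assume SA: "{z 1} \<subseteq> A" "T_part G C \<subseteq> A" "subgroup A G"
        and "g \<in> y ` {1..\<delta>} \<union> z ` {1..\<rho>}"
      then obtain i where i: "i \<in> {1..2}" "g = z i" using \<delta> \<rho> by auto
      then consider "i = 1" | "i = 2" by fastforce
      then show "g \<in> A \<or> g \<in> (\<lambda>a. a \<otimes> z 2) ` A"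
        using SA(1) in_coset[OF SA(3) z12(2)] i by cases auto
    qed (use z12 Shape4 in auto)
  next
    case Shape4s
    then have \<delta>: "\<delta> = 1" and \<rho>: "\<rho> = 2" using shape(1) by auto
    have z12: "z 1 \<in> C" "z 2 \<in> C" using zC \<rho> by auto
    have "y 1 \<in> center_of G C" unfolding center by (rule generate.incl) (simp add: \<delta>)
    then have y1: "y 1 \<in> C" "y 1 \<otimes> z 1 = z 1 \<otimes> y 1" using z12(1) by (auto simp: center_of_def)
    have c: "(y 1 \<otimes> z 1) \<otimes> z 1 = z 1 \<otimes> (y 1 \<otimes> z 1)"
      using y1 car[OF y1(1)] car[OF z12(1)] by (simp add: m_assoc)
    show ?thesis
    proof (rule result[of "{y 1 \<otimes> z 1, z 1}" "z 2"])
      show "{y 1 \<otimes> z 1, z 1} \<subseteq> C" using z12 y1 subgroup.m_closed[OF C] by auto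
      show "s' \<otimes> t = t \<otimes> s'" if "s' \<in> {y 1 \<otimes> z 1, z 1}" "t \<in> {y 1 \<otimes> z 1, z 1}" for s' t
        using that by (elim insertE emptyE) (simp_all only: c)
      show "A = generate G (T_part G C \<union> {y 1 \<otimes> z 1, z 1})" using A Shape4s by simp
      fix g assume SA: "{y 1 \<otimes> z 1, z 1} \<subseteq> A" "T_part G C \<subseteq> A" "subgroup A G"
        and "g \<in> y ` {1..\<delta>} \<union> z ` {1..\<rho>}"
      then consider "g = y 1" | "g = z 1" | "g = z 2"
        unfolding \<delta> \<rho> by (auto simp: atLeastAtMost_iff le_Suc_eq numeral_2_eq_2)
      then show "g \<in> A \<or> g \<in> (\<lambda>a. a \<otimes> z 2) ` A"
      proof cases
        case 1
        have "y 1 = (y 1 \<otimes> z 1) \<otimes> inv (z 1)"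
          using car[OF y1(1)] car[OF z12(1)] by (simp add: m_assoc)
        moreover have "(y 1 \<otimes> z 1) \<otimes> inv (z 1) \<in> A"
          by (rule subgroup.m_closed[OF SA(3) _ subgroup.m_inv_closed[OF SA(3)]]) (use SA in blast)+
        ultimately show ?thesis using 1 by simp
      qed (use SA(1) in_coset[OF SA(3) z12(2)] in auto)
    qed (use z12 Shape4s in auto)
  next
    case Shape5
    then have \<rho>: "\<rho> = 4" and z1sq: "z 1 [^] (2::nat) = u"
      and z34: "z 3 [^] (2::nat) = z 4 [^] (2::nat)"
      and zz: "\<And>j. j \<in> {3, 4} \<Longrightarrow> commutator G (z 1) (z j) \<in> generate G {z j [^] (2::nat)}"
      using shape(1) by auto
    have z: "z 1 \<in> C" "z 3 \<in> C" "z 4 \<in> C" using zC \<rho> by auto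
    note zcar = z[THEN car]
    have fC: "f_elem G z (z 1) \<in> C"
      using z subgroup.m_closed[OF C] by (simp add: f_elem_def)
    have "z 1 \<otimes> f_elem G z (z 1) = f_elem G z (z 1) \<otimes> z 1"
    proof -
      consider "commutator G (z 1) (z 3) = \<one>" | "commutator G (z 1) (z 4) = \<one>" "commutator G (z 1) (z 3) \<noteq> \<one>"
        | "commutator G (z 1) (z 3) \<noteq> \<one>" "commutator G (z 1) (z 4) \<noteq> \<one>" by blast
      then show ?thesis
      proof cases
        case 3
        \<comment> \<open>The subgroup generated by (z j)^2 has at most two elements, so a
          nontrivial commutator in it must be (z j)^2.\<close>
        have sw: "z 1 \<otimes> z j = (z j \<otimes> z j) \<otimes> z j \<otimes> z 1"
          if j: "j \<in> {3, 4}" and ne: "commutator G (z 1) (z j) \<noteq> \<one>" for j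
        proof -
          have zj: "z j \<in> carrier G" using j zcar by auto
          have "commutator G (z 1) (z j) = z j \<otimes> z j"
            using generate_singleton_involution[of "z j \<otimes> z j" "commutator G (z 1) (z j)"] zz[OF j] ne zj
              Z2Z4Q8_square_square[OF zj] by (auto simp: square_eq)
          then show ?thesis using commutator_eq_iff[of "z 1" "z j" "z j \<otimes> z j"] zj zcar(1) by simp
        qed
        \<comment> \<open>Equality of the squares makes both commutators the same element, so they
          cancel on z 3 z 4.\<close>
        have "z 4 \<otimes> z 4 = z 3 \<otimes> z 3" using z34 zcar by (simp add: square_eq)
        then have sw4: "z 1 \<otimes> z 4 = (z 3 \<otimes> z 3) \<otimes> z 4 \<otimes> z 1"
          using sw[OF _ 3(2)] by (simp only: insert_iff refl simp_thms)
        have sw3: "z 1 \<otimes> z 3 = (z 3 \<otimes> z 3) \<otimes> z 3 \<otimes> z 1"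
          by (rule sw[OF _ 3(1)]) (rule insertI1)
        have "z 1 \<otimes> (z 3 \<otimes> z 4) = (z 3 \<otimes> z 4) \<otimes> z 1"
          by (rule swap_twice_right[OF zcar m_closed[OF zcar(2) zcar(2)]
              Z2Z4Q8_square_square[OF zcar(2)] sq_central[OF z(2) z(2)] sw3 sw4])
        then show ?thesis using 3 by (simp add: f_elem_def)
      qed (use commutator_one_iff zcar in \<open>simp_all add: f_elem_def\<close>)
    qed
    then have comm: "s' \<otimes> t = t \<otimes> s'"
      if "s' \<in> {z 1, f_elem G z (z 1)}" "t \<in> {z 1, f_elem G z (z 1)}" for s' t
      using that by auto
    have "{z 1, f_elem G z (z 1)} \<subseteq> C" using z fC by simp
    note ext = torsion_extension[OF C this comm]
    have "A = generate G (T_part G C \<union> {z 1, f_elem G z (z 1)})" using A Shape5 by simp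
    note ext = ext[OF _ _ this]
    have "z 1 \<otimes> z 1 = u" using z1sq zcar by (simp add: square_eq)
    then show ?thesis using ext Shape5 by auto
  qed (use shape in simp_all)
qed

end

theorem mainTheorem3:
  fixes k1 k2 k3 m \<sigma> \<delta> \<rho> \<upsilon> :: nat
    and C A :: "Z2Z4Q8_elem set"
    and x y z :: "nat \<Rightarrow> Z2Z4Q8_elem"
    and s :: shape
  assumes "subgroup C (Z2Z4Q8_group k1 k2 k3)"
    and "hadamard_code (2 ^ m) (gray k1 k2 k3 ` C)"
    and "generated_normally (Z2Z4Q8_group k1 k2 k3) C \<sigma> \<delta> \<rho> x y z"
    and "has_shape (Z2Z4Q8_group k1 k2 k3) (u_elem k1 k2 k3) C \<delta> \<rho> z s"
    and "A = standard_abelian_subgroup (Z2Z4Q8_group k1 k2 k3) C \<rho> y z s"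
    and "order ((Z2Z4Q8_group k1 k2 k3)\<lparr>carrier := C\<rparr> Mod A) = 2 ^ \<upsilon>"
  shows "(\<upsilon> = 1 \<longrightarrow>
           (\<exists>a b D. hadamard_Z2Z4_linear_code a b D \<and>
              is_duplication D (gray k1 k2 k3 ` A))) \<and>
         (\<upsilon> = 2 \<longrightarrow>
           (\<exists>b D. hadamard_Z2Z4_linear_code 0 b D \<and>
              is_quadruplication D (gray k1 k2 k3 ` A)))"
proof -
  let ?G = "Z2Z4Q8_group k1 k2 k3"
  interpret group ?G by (rule group_Z2Z4Q8)
  interpret GC: group "?G\<lparr>carrier := C\<rparr>"
    using assms(1) group_axioms by (rule subgroup.subgroup_is_group)
  have cardC: "card C = 2 * 2 ^ m" by (rule card_hadamard_group[OF assms(1,2)])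
  then have finC: "finite C" by (metis card.infinite mult_eq_0_iff power_eq_0_iff zero_neq_numeral)
  \<comment> \<open>Lagrange with |C| = 2 * 2^m supplies the relation between multiplicity and
    |A|.\<close>
  have index: "2 ^ \<upsilon> * card A = 2 * 2 ^ m" if "subgroup A ?G" "A \<subseteq> C"
  proof -
    have "subgroup A (?G\<lparr>carrier := C\<rparr>)" using subgroup_incl[OF that(1) assms(1) that(2)] .
    from GC.lagrange[OF this] show ?thesis
      using assms(6) cardC by (simp add: FactGroup_def order_def)
  qed
  show ?thesis
  proof (cases "s = Shape1 \<or> s = Shape1s")
    case True
    then have "A = C" using assms(5) by auto
    then have "\<upsilon> = 0" using index assms(1) cardC by auto
    then show ?thesis by simp
  next
    case False
    then have props: "subgroup A ?G" "A \<subseteq> C" "T_part ?G C \<subseteq> A"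
        "\<And>g h. g \<in> A \<Longrightarrow> h \<in> A \<Longrightarrow> g \<otimes>\<^bsub>?G\<^esub> h = h \<otimes>\<^bsub>?G\<^esub> g"
      and s5: "s = Shape5 \<Longrightarrow> \<exists>g\<in>A. g \<otimes>\<^bsub>?G\<^esub> g = u_elem k1 k2 k3"
      and small: "s \<noteq> Shape5 \<Longrightarrow> card C \<le> 2 * card A"
      using standard_abelian_subgroup_properties[OF assms(1,3,4) _ _ assms(5)] finC by auto
    \<comment> \<open>As an element of \<open>C\<close> with trivial square,
      \<open>u_elem k1 k2 k3\<close> lies in T(C), which the standard subgroup contains.\<close>
    have "u_elem k1 k2 k3 \<in> T_part ?G C"
      using u_in_hadamard_code[OF assms(1,2)] u_elem_square T_part_iff[OF assms(1)] by blast
    then have "u_elem k1 k2 k3 \<in> A" using props(3) by blast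
    note rep = abelian_subgroup_replication[OF assms(1,2) props(1,2,4) this index[OF props(1,2)]]
    \<comment> \<open>Index 4 contradicts |C| \<le> 2 |A|, which holds in the other remaining
      shapes.\<close>
    have "s = Shape5" if "\<upsilon> = 2"
    proof (rule ccontr)
      assume "s \<noteq> Shape5"
      then have "card C \<le> 2 * card A" by (rule small)
      moreover have "4 * card A = card C" using index[OF props(1,2)] that cardC by simp
      ultimately show False using cardC zero_less_power[of "2::nat" m] by linarith
    qed
    then have "a = 0"
      if "(\<exists>g\<in>A. g \<otimes>\<^bsub>?G\<^esub> g = u_elem k1 k2 k3) \<longrightarrow> a = 0" "\<upsilon> = 2" for a :: nat
      using that s5 by blast
    moreover obtain a b D where "hadamard_Z2Z4_linear_code a b D"
      "is_replication (2 ^ \<upsilon>) D (gray k1 k2 k3 ` A)"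
      "(\<exists>g\<in>A. g \<otimes>\<^bsub>?G\<^esub> g = u_elem k1 k2 k3) \<longrightarrow> a = 0"
      using rep by blast
    moreover have "(2::nat) ^ \<upsilon> = 2" if "\<upsilon> = 1" using that by simp
    moreover have "(2::nat) ^ \<upsilon> = 4" if "\<upsilon> = 2" using that by simp
    ultimately show ?thesis by metis
  qed
qed

end
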